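(* Let $\beta>7$ be an odd integer. There is a constant $C_\beta$ depending only on $\beta$ such that for every $0<\delta<1/2$, every $f\in L^1(T)$, every $\lambda>\|f\|_1/(2\pi)$ and every strictly increasing sequence $(n_j)_{j\ge1}$ of positive integers, \[ \operatorname{mes}\left\{y\in T:\ \sup_{N\ge1}|T_{N,\beta}f(y)-T_Nf(y)|>\lambda/2\right\}\le C_\beta\,\frac1{1-2\delta}\sqrt{\frac{\|f\|_1}{\lambda}}, \] where \[ T_Nf=\frac1N\sum_{i=1}^N\left(S_{n_i}f-V_{n_i}f\right),\qquad T_{N,\beta}f=\frac1N\sum_{i=1}^N\left(S_{n_i}f-V_{n_i}f\right)\left(\sigma_{m_i}1_{\overline{\beta F_{\beta_i'}}}\right), \] with $m_i=\lfloor n_i/10\rfloor$ and with the numbers $\beta_i'$ (depending on $N$, $\delta$ and $(n_j)$) defined in the context.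
   Context: $T=[-\pi,\pi)$ is regarded as a circle (addition modulo $2\pi$); $\operatorname{mes}(A)=|A|$ is Lebesgue measure; $\|f\|_1=\int_T|f|$; $1_A$ is the characteristic function of $A$ and $\overline A=T\setminus A$; $\log$ is the natural logarithm. For $n\ge 0$, $\mathcal I_n$ is the partition of $T$ into the $2^n$ half-open intervals $[-\pi+2\pi k/2^n,-\pi+2\pi(k+1)/2^n)$, $0\le k<2^n$; the elements of $\mathcal I=\bigcup_{n\ge0}\mathcal I_n$ are the dyadic intervals. For $I\in\mathcal I$ and $i\in\mathbb Z$, $I^{(i)}=I+|I|\,i$ (modulo $T$). For an odd positive integer $\beta$, $\beta I=\bigcup_{|i|\le(\beta-1)/2}I^{(i)}$. Given $f\in L^1(T)$ and $\lambda>\|f\|_1/(2\pi)$: $\mathcal F$ is the set of dyadic intervals $I$ with $|I|^{-1}\int_I|f|>\lambda$ and $|J|^{-1}\int_J|f|\le\lambda$ for every dyadic interval $J\supsetneq I$. For $\epsilon>0$, $\mathcal F_\epsilon=\{I\in\mathcal F:|I|>\epsilon\}$ and $\beta F_\epsilon=\bigcup_{I\in\mathcal F_\epsilon}\beta I$ (so $\beta F_{\beta_i'}=\bigcup_{I\in\mathcal F,\,|I|>\beta_i'}\beta I$). With $\hat f(k)=\frac1{2\pi}\int_Tf(t)e^{-\imath kt}dt$: $S_nf(y)=\sum_{k=-n}^n\hat f(k)e^{\imath ky}$; the Fejér mean is $\sigma_mf=\frac1{m+1}\sum_{k=0}^mS_kf$ ($m\ge0$); the de la Vallée-Poussin mean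 is $V_nf=\frac1n\sum_{j=n}^{2n-1}S_jf$ ($n\ge1$). Definition of $\beta_i'$: for a positive integer $N$ let $K=\lfloor\sqrt N\rfloor$ and $K_0=\lfloor K^{2\delta}\rfloor$. Each $1\le i\le N$ is written uniquely as $i=(j-1)K_0+b$ with integers $1\le j\le N/K_0+1$ and $0\le b<K_0$; then \[ \beta_i'=\frac{20(j+1)\log^2(j+1)}{n_i}. \] *)

theory Defs
  imports "HOL-Analysis.Analysis"
begin

(* The circle is its fundamental domain [-pi, pi); only the values of a function on this set matter. *)
definition circle :: "real set" where
  "circle = {- pi ..< pi}"

abbreviation mes :: "real set \<Rightarrow> real" where
  "mes A \<equiv> measure lebesgue A"

definition L1 :: "(real \<Rightarrow> complex) set" where
  "L1 = {f. set_integrable lebesgue circle f}"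

definition norm1 :: "(real \<Rightarrow> complex) \<Rightarrow> real" where
  "norm1 f = (LINT t:circle|lebesgue. norm (f t))"

definition dyadic_level :: "nat \<Rightarrow> real set set" where
  "dyadic_level n =
     {{- pi + 2 * pi * real k / 2 ^ n ..< - pi + 2 * pi * (real k + 1) / 2 ^ n} | k. k < 2 ^ n}"

definition dyadic :: "real set set" where
  "dyadic = (\<Union>n. dyadic_level n)"

(* I + |I| i, reduced modulo 2 pi into [-pi, pi) *)
definition shift_interval :: "real set \<Rightarrow> int \<Rightarrow> real set" where
  "shift_interval I i =
     {x \<in> circle. \<exists>y\<in>I. \<exists>k::int. x = y + mes I * of_int i + 2 * pi * of_int k}"

(* meant for odd \<beta> *)
definition dilate :: "nat \<Rightarrow> real set \<Rightarrow> real set" where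
  "dilate \<beta> I = (\<Union>i\<in>{i::int. \<bar>i\<bar> \<le> (int \<beta> - 1) div 2}. shift_interval I i)"

definition stopping :: "(real \<Rightarrow> complex) \<Rightarrow> real \<Rightarrow> real set set" where
  "stopping f lam =
     {I \<in> dyadic. (LINT t:I|lebesgue. norm (f t)) / mes I > lam \<and>
        (\<forall>J\<in>dyadic. I \<subset> J \<longrightarrow> (LINT t:J|lebesgue. norm (f t)) / mes J \<le> lam)}"

definition stopping_above :: "(real \<Rightarrow> complex) \<Rightarrow> real \<Rightarrow> real \<Rightarrow> real set set" where
  "stopping_above f lam \<epsilon> = {I \<in> stopping f lam. mes I > \<epsilon>}"

definition dilated_union :: "nat \<Rightarrow> (real \<Rightarrow> complex) \<Rightarrow> real \<Rightarrow> real \<Rightarrow> real set" where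
  "dilated_union \<beta> f lam \<epsilon> = (\<Union>I\<in>stopping_above f lam \<epsilon>. dilate \<beta> I)"

definition fourier_coeff :: "(real \<Rightarrow> complex) \<Rightarrow> int \<Rightarrow> complex" where
  "fourier_coeff f k =
     (LINT t:circle|lebesgue. f t * exp (- \<i> * of_int k * of_real t)) / (2 * of_real pi)"

definition fourier_sum :: "nat \<Rightarrow> (real \<Rightarrow> complex) \<Rightarrow> real \<Rightarrow> complex" where
  "fourier_sum n f y =
     (\<Sum>k\<in>{- int n..int n}. fourier_coeff f k * exp (\<i> * of_int k * of_real y))"

definition fejer_mean :: "nat \<Rightarrow> (real \<Rightarrow> complex) \<Rightarrow> real \<Rightarrow> complex" where
  "fejer_mean m f y = (\<Sum>k\<le>m. fourier_sum k f y) / of_nat (m + 1)"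

(* de la Vallee-Poussin mean, meant for n \<ge> 1 *)
definition vp_mean :: "nat \<Rightarrow> (real \<Rightarrow> complex) \<Rightarrow> real \<Rightarrow> complex" where
  "vp_mean n f y = (\<Sum>j\<in>{n..<2 * n}. fourier_sum j f y) / of_nat n"

definition block_length :: "real \<Rightarrow> nat \<Rightarrow> nat" where
  "block_length \<delta> N = nat \<lfloor>real (nat \<lfloor>sqrt (real N)\<rfloor>) powr (2 * \<delta>)\<rfloor>"

(* The j \<ge> 1 of the decomposition i = (j - 1) K0 + b, 0 \<le> b < K0, with K0 = block_length \<delta> N;
   see block_index_unique. *)
definition block_index :: "real \<Rightarrow> nat \<Rightarrow> nat \<Rightarrow> nat" where
  "block_index \<delta> N i = i div block_length \<delta> N + 1"

lemma block_length_pos: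
  assumes "N \<ge> 1" "\<delta> > 0"
  shows "block_length \<delta> N \<ge> 1"
proof -
  have "\<lfloor>sqrt (real N)\<rfloor> \<ge> 1"
    using assms(1) by simp
  then have "real (nat \<lfloor>sqrt (real N)\<rfloor>) \<ge> 1"
    by linarith
  then have "real (nat \<lfloor>sqrt (real N)\<rfloor>) powr (2 * \<delta>) \<ge> 1"
    using assms(2) by (intro ge_one_powr_ge_zero) auto
  then show ?thesis
    unfolding block_length_def by linarith
qed

lemma block_index_unique:
  assumes "N \<ge> 1" "\<delta> > 0"
  shows "(j \<ge> 1 \<and> (\<exists>b<block_length \<delta> N. i = (j - 1) * block_length \<delta> N + b))
           \<longleftrightarrow> j = block_index \<delta> N i"
proof -
  define K where "K = block_length \<delta> N"
  have K: "K > 0"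
    using block_length_pos[OF assms] by (simp add: K_def)
  show ?thesis
    unfolding block_index_def K_def[symmetric]
  proof
    assume "j \<ge> 1 \<and> (\<exists>b<K. i = (j - 1) * K + b)"
    then obtain b where b: "j \<ge> 1" "b < K" "i = (j - 1) * K + b"
      by blast
    then have "i div K = j - 1"
      by simp
    with b(1) show "j = i div K + 1"
      by simp
  next
    assume "j = i div K + 1"
    then show "j \<ge> 1 \<and> (\<exists>b<K. i = (j - 1) * K + b)"
      using K by (intro conjI exI[of _ "i mod K"]) auto
  qed
qed

definition beta' :: "real \<Rightarrow> (nat \<Rightarrow> nat) \<Rightarrow> nat \<Rightarrow> nat \<Rightarrow> real" where
  "beta' \<delta> n N i =
     (let j = real (block_index \<delta> N i) in 20 * (j + 1) * (ln (j + 1))\<^sup>2 / real (n i))"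

definition T_op :: "(nat \<Rightarrow> nat) \<Rightarrow> nat \<Rightarrow> (real \<Rightarrow> complex) \<Rightarrow> real \<Rightarrow> complex" where
  "T_op n N f y =
     (\<Sum>i=1..N. fourier_sum (n i) f y - vp_mean (n i) f y) / of_nat N"

definition T_loc ::
  "nat \<Rightarrow> real \<Rightarrow> real \<Rightarrow> (nat \<Rightarrow> nat) \<Rightarrow> nat \<Rightarrow> (real \<Rightarrow> complex) \<Rightarrow> real \<Rightarrow> complex" where
  "T_loc \<beta> \<delta> lam n N f y =
     (\<Sum>i=1..N. (fourier_sum (n i) f y - vp_mean (n i) f y) *
        fejer_mean (n i div 10)
          (indicator (circle - dilated_union \<beta> f lam (beta' \<delta> n N i))) y) / of_nat N"

end

theory Submission
  imports Defs
begin

text \<open>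
  Since the Fejer means reproduce constants, \<open>T_loc - T_op\<close> is minus the average of
  \<open>(S - V) f\<close> times the Fejer mean of the indicator of \<open>\<beta>F\<close>.
  Let \<open>M\<close> be the Marcinkiewicz function of the stopping intervals, the sum over \<open>I\<close> of
  \<open>|I|^2 / (|y - I|^2 + |I|^2)\<close>; its integral is at most a constant times \<open>norm1 f / lam\<close>, so
  \<open>{M \<ge> \<eta>}\<close> is an admissible exceptional set.

  Off this set the decay of the Fejer kernel bounds the Fejer mean by a multiple of
  \<open>\<eta> / ((m_i + 1) \<beta>_i')\<close>, and \<open>1 / ((m_i + 1) \<beta>_i') \<le> 2 sqrt N / i\<close> because the block length
  is at most \<open>sqrt N\<close>. Hence the supremum over \<open>N\<close> is at most a multiple of
  \<open>\<eta>\<close> times the sum of \<open>i^(-3/2) |(S - V) f|\<close>, a series that does not depend on \<open>N\<close>.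

  Up to sign and complex conjugation, \<open>S - V\<close> is a sum of two modulated convolutions with the
  one-sided Fejer kernel, whose derivative is at most \<open>4 / |1 - z|^2\<close> uniformly in the degree. A
  Calderon-Zygmund decomposition of the modulated function, along the stopping intervals up to a
  fine dyadic level, splits the convolution into a part that is pointwise at most a multiple of
  \<open>lam\<close> off the exceptional set and a part with square integral at most \<open>2 lam norm1 f\<close>, to
  which Chebyshev's inequality applies. Stopping at a finite level, chosen in terms of the degree,
  avoids the Lebesgue differentiation theorem.
\<close>

section \<open>Chords of the circle\<close>

text \<open>Distance on the circle measured in the plane: it is periodic in both arguments without
  any reduction, obeys the triangle inequality by construction, and equals \<open>|1 - z|\<close>
  for \<open>z = cis (y - t)\<close>, the factor in the closed forms of the kernels.\<close>

definition chord :: "real \<Rightarrow> real \<Rightarrow> real" where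
  "chord y t = cmod (cis y - cis t)"

lemma chord_nonneg [simp]: "0 \<le> chord y t"
  by (simp add: chord_def)

lemma chord_triangle: "chord y a \<le> chord y t + chord t a"
  unfolding chord_def using norm_triangle_ineq[of "cis y - cis t" "cis t - cis a"] by simp

lemma chord_sq: "(chord y t)\<^sup>2 = (2 * sin ((y - t) / 2))\<^sup>2"
proof -
  have "(chord y t)\<^sup>2 = (cos y - cos t)\<^sup>2 + (sin y - sin t)\<^sup>2"
    by (simp add: chord_def cmod_power2)
  also have "\<dots> = ((sin y)\<^sup>2 + (cos y)\<^sup>2) + ((sin t)\<^sup>2 + (cos t)\<^sup>2) - 2 * cos (y - t)"
    by (simp only: cos_diff power2_eq_square) algebra
  also have "\<dots> = (2 * sin ((y - t) / 2))\<^sup>2"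
  proof -
    have "2 * ((y - t) / 2) = y - t" by simp
    then show ?thesis using cos_double_sin[of "(y - t) / 2"] by (simp only: power_mult_distrib) simp
  qed
  finally show ?thesis .
qed

lemma chord_eq: "chord y t = 2 * \<bar>sin ((y - t) / 2)\<bar>"
proof -
  have "\<bar>chord y t\<bar> = \<bar>2 * sin ((y - t) / 2)\<bar>"
    using chord_sq[of y t] by (metis real_sqrt_abs)
  then show ?thesis by (simp add: abs_mult)
qed

lemma chord_le: "chord y t \<le> \<bar>y - t\<bar>"
  using abs_sin_x_le_abs_x[of "(y - t) / 2"] by (simp add: chord_eq)

lemma chord_add_2pi: "chord (y + 2 * pi * of_int k) t = chord y t"
  by (simp add: chord_def flip: cis_mult)

lemma one_minus_cis: "cmod (1 - cis (y - t)) = chord y t"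
proof -
  have "cis y - cis t = - cis t * (1 - cis (y - t))"
    by (simp add: algebra_simps cis_mult)
  then show ?thesis by (simp add: chord_def norm_mult norm_minus_commute)
qed

text \<open>Jordan's inequality with 1/2 in place of 2/pi: as pi/2 is below 1.6, the Taylor
  remainder is at most |x| times 1.6^2 / 6, which is less than |x| / 2.\<close>

lemma abs_le_two_abs_sin:
  fixes x :: real
  assumes "\<bar>x\<bar> \<le> pi / 2"
  shows "\<bar>x\<bar> \<le> 2 * \<bar>sin x\<bar>"
proof -
  have "\<bar>sin x - x\<bar> \<le> \<bar>x\<bar> ^ 3 / 6"
    using Maclaurin_sin_bound[of x 3] by (simp add: sin_coeff_def numeral_eq_Suc)
  also have "\<dots> = \<bar>x\<bar> * x\<^sup>2 / 6"
    by (simp add: power3_eq_cube power2_eq_square)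
  also have "\<dots> \<le> \<bar>x\<bar> * (16/10)\<^sup>2 / 6"
  proof -
    have "\<bar>x\<bar> \<le> 16/10" using assms pi_approx by simp
    then have "x\<^sup>2 \<le> (16/10)\<^sup>2" by (metis abs_ge_zero power2_abs power_mono)
    then show ?thesis by (intro divide_right_mono mult_left_mono) auto
  qed
  finally show ?thesis by (simp add: power2_eq_square abs_if split: if_splits)
qed

text \<open>The integer \<open>k\<close> selects the representative of \<open>y - t\<close> in
  [-pi, pi], where arc length and chord are comparable.\<close>

lemma chord_ge:
  assumes "\<bar>v + 2 * pi * of_int k\<bar> \<le> pi" "v = y - t"
  shows "\<bar>v + 2 * pi * of_int k\<bar> \<le> 2 * chord y t"
proof -
  have "chord y t = chord (y + 2 * pi * of_int k) t" by (simp add: chord_add_2pi)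
  also have "\<dots> = 2 * \<bar>sin ((v + 2 * pi * of_int k) / 2)\<bar>"
    unfolding chord_eq assms(2) by (simp add: algebra_simps)
  finally show ?thesis
    using abs_le_two_abs_sin[of "(v + 2 * pi * of_int k) / 2"] assms(1) by simp
qed

section \<open>Lorentzian bumps and their integrals over the circle\<close>

text \<open>One term of the Marcinkiewicz function, used with \<open>a\<close> the left endpoint of
  an interval and \<open>r\<close> its length.\<close>

definition bump :: "real \<Rightarrow> real \<Rightarrow> real \<Rightarrow> real" where
  "bump a r y = r\<^sup>2 / ((chord y a)\<^sup>2 + r\<^sup>2)"

lemma bump_nonneg [simp]: "0 \<le> bump a r y"
  by (simp add: bump_def)

text \<open>Turns the inverse-square decay of a kernel into a bump: at distance at least
  \<open>r\<close>, both summands in the denominator of the bump are at most the squared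
  chord.\<close>

lemma sq_ratio_le_bump:
  assumes "0 < r" "r \<le> chord y a"
  shows "r\<^sup>2 / (chord y a)\<^sup>2 \<le> 2 * bump a r y"
proof -
  have "r\<^sup>2 \<le> (chord y a)\<^sup>2" using assms by (intro power_mono) auto
  then have "2 * r\<^sup>2 / ((chord y a)\<^sup>2 + (chord y a)\<^sup>2) \<le> 2 * r\<^sup>2 / ((chord y a)\<^sup>2 + r\<^sup>2)"
    using assms by (intro divide_left_mono mult_pos_pos add_pos_pos) auto
  then show ?thesis unfolding bump_def by simp
qed

lemma continuous_chord [continuous_intros]:
  "continuous_on S f \<Longrightarrow> continuous_on S (\<lambda>y. chord (f y) a)"
  unfolding chord_def by (intro continuous_intros)

lemma continuous_bump: "r > 0 \<Longrightarrow> continuous_on S (bump a r)"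
  unfolding bump_def
  by (intro continuous_intros) (auto simp: add_nonneg_eq_0_iff)

lemma circle_sets [measurable, simp]: "circle \<in> sets lebesgue" "circle \<in> sets borel"
  by (auto simp: circle_def)

lemma mes_circle: "mes circle = 2 * pi" "emeasure lebesgue circle = ennreal (2 * pi)"
  "circle \<in> lmeasurable"
  by (auto simp: circle_def fmeasurable_def)

lemma set_integrable_bounded:
  fixes h :: "real \<Rightarrow> 'a::{banach, second_countable_topology}"
  assumes "h \<in> borel_measurable lebesgue" "\<And>t. t \<in> A \<Longrightarrow> norm (h t) \<le> B" "A \<in> lmeasurable"
  shows "set_integrable lebesgue A h"
proof -
  have "integrable lebesgue (\<lambda>t. indicat_real A t * B)"
    using assms(3) by (intro integrable_mult_left) (auto simp: fmeasurable_def)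
  then show ?thesis
    unfolding set_integrable_def
  proof (rule Bochner_Integration.integrable_bound)
    show "(\<lambda>x. indicat_real A x *\<^sub>R h x) \<in> borel_measurable lebesgue"
      using assms(1,3) by (intro borel_measurable_scaleR borel_measurable_indicator) (auto simp: fmeasurable_def)
    show "AE x in lebesgue. norm (indicat_real A x *\<^sub>R h x) \<le> norm (indicat_real A x * B)"
      by (rule AE_I2) (auto simp: indicator_def dest: assms(2))
  qed
qed

lemma set_integrable_continuous_circle:
  fixes h :: "real \<Rightarrow> 'a::{euclidean_space}"
  assumes "continuous_on UNIV h"
  shows "set_integrable lebesgue circle h"
proof -
  have "compact (h ` {-pi..pi})"
    using assms by (intro compact_continuous_image) (auto intro: continuous_on_subset)
  then obtain B where "\<And>t. t \<in> {-pi..pi} \<Longrightarrow> norm (h t) \<le> B"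
    by (metis bounded_iff compact_imp_bounded imageI)
  moreover have "h \<in> borel_measurable lebesgue"
    using borel_measurable_continuous_onI[OF assms] by (auto simp: measurable_completion)
  ultimately show ?thesis
    by (intro set_integrable_bounded[where B = B]) (auto simp: circle_def fmeasurable_def)
qed

text \<open>The primitive \<open>r * arctan ((y - b) / r)\<close> oscillates by at most
  \<open>pi * r\<close>, wherever the centre \<open>b\<close> lies; centres outside the circle occur
  below.\<close>

lemma integral_lorentzian_le:
  fixes b r :: real
  assumes "r > 0"
  shows "(LINT y:circle|lebesgue. r\<^sup>2 / ((y - b)\<^sup>2 + r\<^sup>2)) \<le> pi * r"
proof -
  define h where "h = (\<lambda>y. r\<^sup>2 / ((y - b)\<^sup>2 + r\<^sup>2))"
  have pos: "(y - b)\<^sup>2 + r\<^sup>2 > 0" for y using assms by (simp add: sum_power2_gt_zero_iff)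
  then have ne: "(y - b)\<^sup>2 + r\<^sup>2 \<noteq> 0" for y by (metis less_irrefl)
  have cont: "continuous_on UNIV h"
    unfolding h_def using ne by (intro continuous_intros) auto
  have int: "set_integrable lebesgue circle h" 
    by (rule set_integrable_continuous_circle[OF cont])
  have "(h has_integral r * arctan ((pi - b) / r) - r * arctan ((- pi - b) / r)) {-pi..pi}"
  proof (rule fundamental_theorem_of_calculus)
    fix x :: real assume "x \<in> {-pi..pi}"
    have "((\<lambda>y. r * arctan ((y - b) / r)) has_real_derivative h x) (at x within {-pi..pi})"
      unfolding h_def using assms ne[of x]
      by (auto intro!: derivative_eq_intros simp: field_simps power2_eq_square)
    then show "((\<lambda>y. r * arctan ((y - b) / r)) has_vector_derivative h x) (at x within {-pi..pi})"
      by (simp add: has_real_derivative_iff_has_vector_derivative)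
  qed auto
  then have *: "integral {-pi..pi} h = r * arctan ((pi - b) / r) - r * arctan ((- pi - b) / r)"
    and ii: "h integrable_on {-pi..pi}" by (auto intro: integral_unique)
  have "(LINT y:circle|lebesgue. h y) = integral circle h"
    using int by (rule set_lebesgue_integral_eq_integral)
  also have "\<dots> \<le> integral {-pi..pi} h"
    using set_lebesgue_integral_eq_integral[OF int] ii pos int
    by (intro integral_subset_le) (auto simp: circle_def h_def set_lebesgue_integral_eq_integral less_imp_le)
  also have "\<dots> = r * (arctan ((pi - b) / r) - arctan ((- pi - b) / r))"
    by (simp add: * algebra_simps)
  also have "\<dots> \<le> r * pi"
    using arctan_bounded[of "(pi - b) / r"] arctan_bounded[of "(- pi - b) / r"] assms
    by (intro mult_left_mono) auto
  finally show ?thesis by (simp add: h_def mult.commute)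
qed

text \<open>One of the shifts by -2 pi, 0, 2 pi moves \<open>y - a\<close> into [-pi, pi], where arc
  length is at most twice the chord. The squared 2 and the three shifts give 4 * 3 = 12. Linearity
  in \<open>r\<close> makes the sum over disjoint intervals cost their total length.\<close>

lemma integral_bump_le:
  assumes "r > 0" "a \<in> circle"
  shows "(LINT y:circle|lebesgue. bump a r y) \<le> 12 * pi * r"
proof -
  define h where "h = (\<lambda>k::int. \<lambda>y. r\<^sup>2 / ((y - (a - 2 * pi * of_int k))\<^sup>2 + r\<^sup>2))"
  have "((y - (a - 2 * pi * of_int k))\<^sup>2 + r\<^sup>2) \<noteq> 0" for y k
    using assms by (simp add: add_nonneg_eq_0_iff)
  then have ih: "set_integrable lebesgue circle (h k)" for k
    unfolding h_def by (intro set_integrable_continuous_circle continuous_intros) auto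
  have "bump a r y \<le> 4 * (h (-1) y + h 0 y + h 1 y)" if "y \<in> circle" for y
  proof -
    have "\<exists>k\<in>{-1,0,1::int}. \<bar>(y - a) + 2 * pi * of_int k\<bar> \<le> pi"
    proof -
      consider "y - a > pi" | "\<bar>y - a\<bar> \<le> pi" | "y - a < - pi" by linarith
      then show ?thesis using that assms(2) by cases (auto simp: circle_def)
    qed
    then obtain k where k: "k \<in> {-1,0,1::int}" and "\<bar>(y - a) + 2 * pi * of_int k\<bar> \<le> pi"
      by blast
    then have "\<bar>(y - a) + 2 * pi * of_int k\<bar> \<le> 2 * chord y a"
      by (intro chord_ge) auto
    then have "((y - a) + 2 * pi * of_int k)\<^sup>2 \<le> (2 * chord y a)\<^sup>2"
      by (metis abs_ge_zero power2_abs power_mono)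
    then have "(y - (a - 2 * pi * of_int k))\<^sup>2 + r\<^sup>2 \<le> 4 * ((chord y a)\<^sup>2 + r\<^sup>2)"
      by (simp add: power_mult_distrib algebra_simps) (erule order_trans, simp)
    then have "bump a r y \<le> 4 * h k y"
      unfolding bump_def h_def using assms(1)
      by (simp add: divide_simps add_nonneg_eq_0_iff mult.commute) (auto simp: not_less sum_power2_gt_zero_iff)
    also have "\<dots> \<le> 4 * (h (-1) y + h 0 y + h 1 y)"
      using k by (auto simp: h_def)
    finally show ?thesis .
  qed
  then have "(LINT y:circle|lebesgue. bump a r y) \<le> (LINT y:circle|lebesgue. 4 * (h (-1) y + h 0 y + h 1 y))"
  proof (intro set_integral_mono)
    show "set_integrable lebesgue circle (bump a r)"
      using assms(1) by (intro set_integrable_continuous_circle continuous_bump)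
    show "set_integrable lebesgue circle (\<lambda>y. 4 * (h (-1) y + h 0 y + h 1 y))"
      using ih by (intro set_integrable_mult_right set_integral_add(1)) auto
  qed auto
  also have "\<dots> = 4 * ((LINT y:circle|lebesgue. h (-1) y) + (LINT y:circle|lebesgue. h 0 y) + (LINT y:circle|lebesgue. h 1 y))"
    using ih by (simp add: set_integral_add)
  also have "\<dots> \<le> 4 * (pi * r + pi * r + pi * r)"
    unfolding h_def using assms(1) by (intro mult_left_mono add_mono integral_lorentzian_le) auto
  finally show ?thesis by simp
qed

section \<open>Trigonometric polynomials\<close>

lemma set_integral_sum:
  fixes f :: "'i \<Rightarrow> 'a \<Rightarrow> 'b::{banach, second_countable_topology}"
  assumes "\<And>i. i \<in> I \<Longrightarrow> set_integrable M A (f i)"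
  shows "set_lebesgue_integral M A (\<lambda>x. \<Sum>i\<in>I. f i x) = (\<Sum>i\<in>I. set_lebesgue_integral M A (f i))"
    and "set_integrable M A (\<lambda>x. \<Sum>i\<in>I. f i x)"
  using assms unfolding set_integrable_def set_lebesgue_integral_def
  by (simp_all add: scaleR_sum_right)

lemma set_integrable_mult_bounded:
  fixes f h :: "real \<Rightarrow> complex"
  assumes "set_integrable lebesgue A f" "h \<in> borel_measurable lebesgue"
    and "\<And>t. norm (h t) \<le> B"
  shows "set_integrable lebesgue A (\<lambda>t. h t * f t)"
proof -
  have "integrable lebesgue (\<lambda>t. B *\<^sub>R (indicat_real A t *\<^sub>R f t))"
    using assms(1) unfolding set_integrable_def by (intro integrable_scaleR_right) auto
  moreover have "(\<lambda>x. indicat_real A x *\<^sub>R (h x * f x)) \<in> borel_measurable lebesgue"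
    using borel_measurable_times[OF assms(2), of "\<lambda>x. indicat_real A x *\<^sub>R f x"] assms(1)
    by (simp add: set_integrable_def borel_measurable_integrable scaleR_conv_of_real mult.left_commute)
  moreover have "norm (indicat_real A x *\<^sub>R (h x * f x)) \<le> norm (B *\<^sub>R (indicat_real A x *\<^sub>R f x))" for x
    using assms(3)[of x] by (auto simp: indicator_def norm_mult intro!: mult_right_mono)
  ultimately show ?thesis
    unfolding set_integrable_def
    by (elim Bochner_Integration.integrable_bound) (auto intro!: AE_I2)
qed

lemma continuous_imp_borel_measurable_lebesgue:
  fixes h :: "real \<Rightarrow> 'a::{euclidean_space}"
  assumes "continuous_on UNIV h" shows "h \<in> borel_measurable lebesgue"
  using borel_measurable_continuous_onI[OF assms] by (auto simp: measurable_completion)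

lemma fourier_coeff_cis:
  "fourier_coeff f k = (LINT t:circle|lebesgue. cis (- of_int k * t) * f t) / (2 * of_real pi)"
  by (simp add: fourier_coeff_def cis_conv_exp mult.commute mult.left_commute)

lemma set_integrable_cis_mult:
  "f \<in> L1 \<Longrightarrow> set_integrable lebesgue circle (\<lambda>t. cis (c * t) * f t)"
  by (intro set_integrable_mult_bounded[where B = 1] continuous_imp_borel_measurable_lebesgue continuous_intros)
     (auto simp: L1_def)

text \<open>The weights are arbitrary because this serves the Dirichlet sums, the one-sided mean
  and, at \<open>y = 0\<close>, the pairing with a conjugated trigonometric polynomial.\<close>

lemma fourier_kernel:
  assumes "f \<in> L1" "finite S"
  shows "(\<Sum>k\<in>S. a k * fourier_coeff f k * cis (of_int k * y)) =
    (LINT t:circle|lebesgue. (\<Sum>k\<in>S. a k * cis (of_int k * (y - t))) * f t) / (2 * of_real pi)"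
proof -
  have "(LINT t:circle|lebesgue. (\<Sum>k\<in>S. a k * cis (of_int k * (y - t))) * f t)
      = (LINT t:circle|lebesgue. (\<Sum>k\<in>S. (a k * cis (of_int k * y)) * (cis (- of_int k * t) * f t)))"
    by (intro set_lebesgue_integral_cong)
       (auto simp: sum_distrib_right mult.assoc cis_mult intro!: sum.cong, simp add: mult.left_commute cis_mult algebra_simps)
  also have "\<dots> = (\<Sum>k\<in>S. LINT t:circle|lebesgue. (a k * cis (of_int k * y)) * (cis (- of_int k * t) * f t))"
    by (intro set_integral_sum(1) set_integrable_mult_right set_integrable_cis_mult assms(1))
  also have "\<dots> = (\<Sum>k\<in>S. (a k * cis (of_int k * y)) * (2 * of_real pi * fourier_coeff f k))"
    by (intro sum.cong refl) (simp add: fourier_coeff_cis)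
  finally show ?thesis
    by (simp add: sum_divide_distrib mult.commute mult.left_commute)
qed

lemma integral_cis:
  "(LINT t:circle|lebesgue. cis (of_int k * t)) = (if k = 0 then 2 * of_real pi else 0)"
proof (cases "k = 0")
  case True
  then show ?thesis by (simp add: mes_circle set_lebesgue_integral_def scaleR_conv_of_real)
next
  case False
  have "((\<lambda>t. cis (of_int k * t)) has_integral
      inverse (\<i> * of_int k) * cis (of_int k * pi) - inverse (\<i> * of_int k) * cis (of_int k * (- pi))) {-pi..pi}"
  proof (rule fundamental_theorem_of_calculus)
    fix x :: real
    have "((\<lambda>t. cis (of_int k * t)) has_vector_derivative \<i> * of_int k * cis (of_int k * x)) (at x within {-pi..pi})"
      unfolding cis_conv_exp
      by (auto intro!: derivative_eq_intros has_vector_derivative_real_field simp: mult.assoc)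
    from has_vector_derivative_mult_right[OF this, of "inverse (\<i> * of_int k)"]
    have "((\<lambda>t. inverse (\<i> * of_int k) * cis (of_int k * t)) has_vector_derivative
      inverse (\<i> * of_int k) * (\<i> * of_int k * cis (of_int k * x))) (at x within {-pi..pi})" .
    moreover have "inverse (\<i> * of_int k) * (\<i> * of_int k * z) = z" for z
    proof -
      have "inverse c * (c * z) = z" if "c \<noteq> 0" for c :: complex
        using that by simp
      from this[of "\<i> * of_int k"] show ?thesis using False by (simp only: mult_eq_0_iff of_int_eq_0_iff complex_i_not_zero) simp
    qed
    ultimately show "((\<lambda>t. inverse (\<i> * of_int k) * cis (of_int k * t)) has_vector_derivative cis (of_int k * x)) (at x within {-pi..pi})"
      by (simp only:)
  qed auto
  moreover have "cis (of_int k * pi) = cis (of_int k * (- pi))"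
    using sin_zero_iff_int2[of "of_int k * pi"] by (simp add: complex_eq_iff)
  ultimately have *: "((\<lambda>t. cis (of_int k * t)) has_integral 0) {-pi..pi}" by simp
  have "set_integrable lebesgue circle (\<lambda>t. cis (of_int k * t))"
    by (intro set_integrable_continuous_circle continuous_intros)
  then have "(LINT t:circle|lebesgue. cis (of_int k * t)) = integral circle (\<lambda>t. cis (of_int k * t))"
    by (rule set_lebesgue_integral_eq_integral)
  also have "\<dots> = integral {-pi..pi} (\<lambda>t. cis (of_int k * t))"
    by (rule integral_spike_set) (auto simp: circle_def intro: negligible_subset[of "{pi}"])
  also have "\<dots> = 0" using * by (rule integral_unique)
  finally show ?thesis using False by simp
qed

lemma fourier_coeff_trig_poly:
  assumes "finite S"
  shows "fourier_coeff (\<lambda>t. \<Sum>k\<in>S. c k * cis (of_int k * t)) m = (if m \<in> S then c m else 0)"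
proof -
  have "(LINT t:circle|lebesgue. cis (- of_int m * t) * (\<Sum>k\<in>S. c k * cis (of_int k * t)))
     = (LINT t:circle|lebesgue. (\<Sum>k\<in>S. c k * cis (of_int (k - m) * t)))"
    by (intro set_lebesgue_integral_cong)
       (auto simp: sum_distrib_left cis_mult algebra_simps intro!: sum.cong)
  also have "\<dots> = (\<Sum>k\<in>S. LINT t:circle|lebesgue. c k * cis (of_int (k - m) * t))"
    by (intro set_integral_sum(1) set_integrable_continuous_circle continuous_intros)
  also have "\<dots> = (\<Sum>k\<in>S. if k = m then c m * (2 * of_real pi) else 0)"
    by (intro sum.cong refl) (simp only: set_integral_mult_right integral_cis, simp)
  also have "\<dots> = (if m \<in> S then c m * (2 * of_real pi) else 0)"
    using assms by simp
  finally show ?thesis by (simp add: fourier_coeff_cis)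
qed

lemma integral_mult_cnj_trig_poly:
  assumes "f \<in> L1" "finite S"
  shows "(LINT t:circle|lebesgue. cnj (\<Sum>k\<in>S. c k * cis (of_int k * t)) * f t)
    = 2 * of_real pi * (\<Sum>k\<in>S. cnj (c k) * fourier_coeff f k)"
proof -
  have "(LINT t:circle|lebesgue. cnj (\<Sum>k\<in>S. c k * cis (of_int k * t)) * f t)
     = (LINT t:circle|lebesgue. (\<Sum>k\<in>S. cnj (c k) * cis (of_int k * (0 - t))) * f t)"
    by (intro set_lebesgue_integral_cong) (auto simp: cis_cnj)
  then show ?thesis using fourier_kernel[OF assms, of "\<lambda>k. cnj (c k)" 0]
    by (simp)
qed

text \<open>A Bessel argument. With \<open>h\<close> the multiplied polynomial,
  \<open>0 \<le> a k \<le> 1\<close> gives \<open>(a k)\<^sup>2 \<le> a k\<close>, so the squared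
  norm of \<open>h\<close> is at most the real inner product of \<open>g\<close> and
  \<open>h\<close>. Expanding the nonnegative squared norm of \<open>g - h\<close> then leaves the
  claim.\<close>

lemma multiplier_L2:
  fixes g :: "real \<Rightarrow> complex"
  assumes "g \<in> borel_measurable lebesgue" "\<And>t. norm (g t) \<le> B" "finite S"
    and a: "\<And>k. k \<in> S \<Longrightarrow> 0 \<le> a k \<and> a k \<le> 1"
  shows "(LINT t:circle|lebesgue. (norm (\<Sum>k\<in>S. of_real (a k) * fourier_coeff g k * cis (of_int k * t)))\<^sup>2)
    \<le> (LINT t:circle|lebesgue. (norm (g t))\<^sup>2)"
proof -
  define c where "c = (\<lambda>k. of_real (a k) * fourier_coeff g k)"
  define h where "h = (\<lambda>t. \<Sum>k\<in>S. c k * cis (of_int k * t))"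
  have hc: "continuous_on A h" for A
    unfolding h_def by (intro continuous_intros)
  have g1: "g \<in> L1"
    unfolding L1_def using assms(1,2) by (auto intro!: set_integrable_bounded simp: mes_circle)
  have h1: "h \<in> L1"
    unfolding L1_def using hc by (auto intro!: set_integrable_continuous_circle)
  have hb: "\<exists>B. \<forall>t. norm (h t) \<le> B"
  proof (intro exI allI)
    fix t show "norm (h t) \<le> (\<Sum>k\<in>S. norm (c k))"
      unfolding h_def by (rule order_trans[OF norm_sum]) (simp add: norm_mult)
  qed
  have i1: "set_integrable lebesgue circle (\<lambda>t. (norm (g t))\<^sup>2)"
    using assms(1,2) power_mono[OF assms(2) norm_ge_zero]
    by (intro set_integrable_bounded[where B = "B\<^sup>2"]) (auto simp: mes_circle)
  have i2: "set_integrable lebesgue circle (\<lambda>t. (norm (h t))\<^sup>2)"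
    by (intro set_integrable_continuous_circle continuous_intros hc)
  have i3: "set_integrable lebesgue circle (\<lambda>t. cnj (h t) * g t)"
  proof -
    obtain B' where "\<And>t. norm (h t) \<le> B'" using hb by blast
    then show ?thesis using g1 
      by (intro set_integrable_mult_bounded[where B = B'] continuous_imp_borel_measurable_lebesgue continuous_intros hc)
         (auto simp: L1_def)
  qed
  have gh: "(LINT t:circle|lebesgue. Re (cnj (h t) * g t)) = 2 * pi * (\<Sum>k\<in>S. a k * (norm (fourier_coeff g k))\<^sup>2)"
  proof -
    have "(LINT t:circle|lebesgue. Re (cnj (h t) * g t)) = Re (LINT t:circle|lebesgue. cnj (h t) * g t)"
      using integral_Re[OF i3[unfolded set_integrable_def]] by (simp add: set_lebesgue_integral_def)
    also have "\<dots> = Re (2 * of_real pi * (\<Sum>k\<in>S. cnj (c k) * fourier_coeff g k))"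
      unfolding h_def by (simp only: integral_mult_cnj_trig_poly[OF g1 assms(3)])
    also have "(\<Sum>k\<in>S. cnj (c k) * fourier_coeff g k) = of_real (\<Sum>k\<in>S. a k * (norm (fourier_coeff g k))\<^sup>2)"
      unfolding c_def of_real_sum
      by (intro sum.cong refl) (simp add: complex_norm_square mult.commute mult.left_commute del: of_real_power)
    finally show ?thesis by simp
  qed
  have hh: "(LINT t:circle|lebesgue. (norm (h t))\<^sup>2) = 2 * pi * (\<Sum>k\<in>S. (a k)\<^sup>2 * (norm (fourier_coeff g k))\<^sup>2)"
  proof -
    have "of_real (LINT t:circle|lebesgue. (norm (h t))\<^sup>2) = (LINT t:circle|lebesgue. of_real ((norm (h t))\<^sup>2) :: complex)"
      unfolding set_lebesgue_integral_def integral_complex_of_real[symmetric] by (simp add: scaleR_conv_of_real)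
    also have "\<dots> = (LINT t:circle|lebesgue. cnj (h t) * h t)"
      by (intro set_lebesgue_integral_cong) (auto simp: complex_norm_square mult.commute simp del: of_real_power)
    also have "\<dots> = 2 * of_real pi * (\<Sum>k\<in>S. cnj (c k) * fourier_coeff h k)"
      using integral_mult_cnj_trig_poly[OF h1 assms(3)] by (simp add: h_def)
    also have "\<dots> = 2 * of_real pi * (\<Sum>k\<in>S. cnj (c k) * c k)"
      unfolding h_def fourier_coeff_trig_poly[OF assms(3)] by (simp cong: sum.cong)
    also have "(\<Sum>k\<in>S. cnj (c k) * c k) = of_real (\<Sum>k\<in>S. (a k)\<^sup>2 * (norm (fourier_coeff g k))\<^sup>2)"
      unfolding c_def of_real_sum
      by (intro sum.cong refl) (simp add: complex_norm_square power2_eq_square[of "a _"] mult.commute mult.left_commute del: of_real_power)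
    also have "2 * complex_of_real pi * of_real (\<Sum>k\<in>S. (a k)\<^sup>2 * (norm (fourier_coeff g k))\<^sup>2)
      = of_real (2 * pi * (\<Sum>k\<in>S. (a k)\<^sup>2 * (norm (fourier_coeff g k))\<^sup>2))" by simp
    finally show ?thesis by (simp only: of_real_eq_iff)
  qed
  have "0 \<le> (LINT t:circle|lebesgue. (norm (g t - h t))\<^sup>2)"
    unfolding set_lebesgue_integral_def by (intro integral_nonneg_AE AE_I2) auto
  also have "\<dots> = (LINT t:circle|lebesgue. (norm (g t))\<^sup>2 + (norm (h t))\<^sup>2 - 2 * Re (cnj (h t) * g t))"
    by (intro set_lebesgue_integral_cong allI impI)
       (simp_all only: cmod_power2 circle_sets, simp add: power2_eq_square algebra_simps)
  also have "\<dots> = (LINT t:circle|lebesgue. (norm (g t))\<^sup>2) + (LINT t:circle|lebesgue. (norm (h t))\<^sup>2)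
     - 2 * (LINT t:circle|lebesgue. Re (cnj (h t) * g t))"
  proof -
    have "set_integrable lebesgue circle (\<lambda>t. Re (cnj (h t) * g t))"
      using integrable_Re[OF i3[unfolded set_integrable_def]] by (simp add: set_integrable_def)
    then show ?thesis using i1 i2 by (simp only: set_integral_add set_integral_diff set_integral_mult_right set_integrable_mult_right)
  qed
  finally have "2 * (LINT t:circle|lebesgue. Re (cnj (h t) * g t))
    \<le> (LINT t:circle|lebesgue. (norm (g t))\<^sup>2) + (LINT t:circle|lebesgue. (norm (h t))\<^sup>2)" by simp
  moreover have "(LINT t:circle|lebesgue. (norm (h t))\<^sup>2) \<le> (LINT t:circle|lebesgue. Re (cnj (h t) * g t))"
    unfolding gh hh using a
    by (intro mult_left_mono sum_mono mult_right_mono) (auto simp: power2_eq_square intro: mult_left_le)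
  ultimately have "(LINT t:circle|lebesgue. (norm (h t))\<^sup>2) \<le> (LINT t:circle|lebesgue. (norm (g t))\<^sup>2)" by linarith
  then show ?thesis by (simp add: h_def c_def)
qed

section \<open>The one-sided and the two-sided Fejer kernel\<close>

text \<open>This is the increment in the induction for the quadratic coefficients below, since
  \<open>Suc n - k = (n - k) + 1\<close>.\<close>

lemma one_minus_sq_sum_id:
  fixes z :: complex
  shows "(1 - z)\<^sup>2 * (\<Sum>k\<le>n. of_nat k * z ^ k) = z - of_nat (n + 1) * z ^ (n + 1) + of_nat n * z ^ (n + 2)"
  by (induction n) (simp_all add: algebra_simps power2_eq_square)

text \<open>The coefficients of the derivative of the one-sided Fejer kernel are summed by parts
  twice: their second differences have total variation at most \<^term>\<open>4 * n\<close>.\<close>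
lemma one_minus_sq_sum_quadratic:
  fixes z :: complex
  assumes "n \<ge> 1"
  shows "(1 - z)\<^sup>2 * (\<Sum>k\<le>n. of_nat k * of_nat (n - k) * z ^ k)
    = of_nat (n - 1) * z + of_nat (n - 1) * z ^ (n + 1) - 2 * (\<Sum>k=2..n. z ^ k)"
  using assms
proof (induction n rule: dec_induct)
  case base
  then show ?case by (simp add: numeral_2_eq_2)
next
  case (step n)
  have "(\<Sum>k\<le>Suc n. of_nat k * of_nat (Suc n - k) * z ^ k)
      = (\<Sum>k\<le>n. of_nat k * of_nat (n - k) * z ^ k) + (\<Sum>k\<le>n. of_nat k * z ^ k)"
    by (auto simp: sum.distrib[symmetric] Suc_diff_le algebra_simps intro!: sum.cong)
  then have "(1 - z)\<^sup>2 * (\<Sum>k\<le>Suc n. of_nat k * of_nat (Suc n - k) * z ^ k)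
      = (of_nat (n - 1) * z + of_nat (n - 1) * z ^ (n + 1) - 2 * (\<Sum>k=2..n. z ^ k))
        + (z - of_nat (n + 1) * z ^ (n + 1) + of_nat n * z ^ (n + 2))"
    by (simp only: distrib_left step.IH one_minus_sq_sum_id)
  also have "\<dots> = of_nat n * z + of_nat n * z ^ (n + 2) - 2 * (\<Sum>k=2..Suc n. z ^ k)"
  proof -
    obtain m where "n = Suc m" using step.hyps by (cases n) auto
    then show ?thesis by (simp add: algebra_simps)
  qed
  finally show ?case by simp
qed

text \<open>The positive-frequency part of the Fejer kernel. It decays only like 1 / |1 - z|, as a
  Cauchy kernel does, so it is handled through its derivative and cancellation.\<close>

definition one_sided_fejer :: "nat \<Rightarrow> real \<Rightarrow> complex" where
  "one_sided_fejer n u = (\<Sum>l=1..n. of_real (1 - real l / real n) * cis (real l * u))"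

lemma one_sided_fejer_deriv:
  "(one_sided_fejer n has_vector_derivative
    \<i> * (\<Sum>l=1..n. of_real (real l * (1 - real l / real n)) * cis (real l * u))) (at u within S)"
proof -
  have "((\<lambda>u. cis (real l * u)) has_vector_derivative \<i> * of_real (real l) * cis (real l * u)) (at u within S)" for l
    unfolding cis_conv_exp
    by (auto intro!: derivative_eq_intros has_vector_derivative_real_field simp: mult.assoc)
  then have "((\<lambda>u. \<Sum>l=1..n. of_real (1 - real l / real n) * cis (real l * u)) has_vector_derivative
    (\<Sum>l=1..n. of_real (1 - real l / real n) * (\<i> * of_real (real l) * cis (real l * u)))) (at u within S)"
    by (intro has_vector_derivative_sum has_vector_derivative_mult_right)
  then show ?thesis
    unfolding one_sided_fejer_def[abs_def]
    by (simp add: sum_distrib_left mult.assoc mult.left_commute)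
qed

text \<open>The weights are l (n - l) / n. In the identity for the quadratic coefficients the three
  pieces have norms at most n - 1, n - 1 and 2 (n - 1), so division by n leaves at most 4, uniformly
  in the degree.\<close>

lemma one_sided_fejer_deriv_le:
  assumes "n \<ge> 1"
  shows "norm (1 - cis u) ^ 2 * norm (\<Sum>l=1..n. of_real (real l * (1 - real l / real n)) * cis (real l * u)) \<le> 4"
proof -
  have "(\<Sum>l=1..n. of_real (real l * (1 - real l / real n)) * cis (real l * u))
     = (\<Sum>l\<le>n. of_real (real l * (1 - real l / real n)) * cis (real l * u))"
    by (intro sum.mono_neutral_left) auto
  also have "\<dots> = (\<Sum>l\<le>n. of_nat l * of_nat (n - l) * cis u ^ l) / of_nat n"
    unfolding sum_divide_distrib
  proof (intro sum.cong refl)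
    fix l assume "l \<in> {..n}"
    then show "of_real (real l * (1 - real l / real n)) * cis (real l * u)
        = of_nat l * of_nat (n - l) * cis u ^ l / of_nat n"
      using assms by (simp only: Complex.DeMoivre) (simp add: of_nat_diff field_simps)
  qed
  finally have "norm (1 - cis u) ^ 2 * norm (\<Sum>l=1..n. of_real (real l * (1 - real l / real n)) * cis (real l * u))
     = norm ((1 - cis u)\<^sup>2 * (\<Sum>l\<le>n. of_nat l * of_nat (n - l) * cis u ^ l)) / real n"
    by (simp add: norm_mult norm_power norm_divide)
  also have "\<dots> \<le> (real (n - 1) + real (n - 1) + 2 * real (n - 1)) / real n"
  proof (rule divide_right_mono)
    have "norm (\<Sum>k=2..n. cis u ^ k) \<le> (\<Sum>k=2..n. 1)"
      by (intro sum_norm_le) (simp add: norm_power)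
    then have "norm (2 * (\<Sum>k=2..n. cis u ^ k)) \<le> 2 * real (n - 1)"
      by (simp add: norm_mult)
    then show "norm ((1 - cis u)\<^sup>2 * (\<Sum>l\<le>n. of_nat l * of_nat (n - l) * cis u ^ l))
      \<le> real (n - 1) + real (n - 1) + 2 * real (n - 1)"
      unfolding one_minus_sq_sum_quadratic[OF assms]
      by (intro norm_triangle_le_diff norm_triangle_le add_mono) (auto simp: norm_mult norm_power)
  qed simp
  also have "\<dots> \<le> 4" using assms by (simp add: divide_le_eq)
  finally show ?thesis .
qed

lemma norm_diff_le_of_vector_derivative:
  fixes f :: "real \<Rightarrow> 'b::real_normed_vector"
  assumes "\<And>x. (f has_vector_derivative f' x) (at x)"
    and "\<And>x. x \<in> closed_segment a b \<Longrightarrow> norm (f' x) \<le> B"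
  shows "norm (f a - f b) \<le> B * \<bar>a - b\<bar>"
proof -
  have "norm (f a - f b) \<le> B * norm (a - b)"
  proof (rule differentiable_bound[where S = "closed_segment a b" and f' = "\<lambda>x h. h *\<^sub>R f' x"])
    fix x assume "x \<in> closed_segment a b"
    then show "onorm (\<lambda>h. h *\<^sub>R f' x) \<le> B"
      using assms(2)[of x] by (simp add: onorm_scaleR_left onorm_id)
    show "(f has_derivative (\<lambda>h. h *\<^sub>R f' x)) (at x within closed_segment a b)"
      using assms(1)[of x] has_derivative_at_withinI unfolding has_vector_derivative_def by blast
  qed auto
  then show ?thesis by simp
qed

text \<open>A crude bound, n terms of size at most n in the derivative. It serves the intervals from
  which \<open>y\<close> has no distance, where a fine scale compensates for the growth in
  n.\<close>

lemma one_sided_fejer_lipschitz: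
  assumes "n \<ge> 1" 
  shows "norm (one_sided_fejer n u - one_sided_fejer n v) \<le> (real n)\<^sup>2 * \<bar>u - v\<bar>"
proof (rule norm_diff_le_of_vector_derivative[OF one_sided_fejer_deriv])
  fix x
  have "norm (\<Sum>l=1..n. of_real (real l * (1 - real l / real n)) * cis (real l * x)) \<le> (\<Sum>l=1..n. real n)"
  proof (rule sum_norm_le)
    fix l assume l: "l \<in> {1..n}"
    then have "real l * (1 - real l / real n) \<le> real n * 1" "0 \<le> real l * (1 - real l / real n)"
      by (intro mult_mono mult_nonneg_nonneg; simp)+
    then show "norm (of_real (real l * (1 - real l / real n)) * cis (real l * x)) \<le> real n"
      by (simp only: norm_mult norm_cis norm_of_real)
  qed
  then show "norm (\<i> * (\<Sum>l=1..n. of_real (real l * (1 - real l / real n)) * cis (real l * x))) \<le> (real n)\<^sup>2"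
    by (simp add: norm_mult power2_eq_square)
qed

text \<open>The Hoermander-type smoothness of the kernel: the derivative is at most 4 over the
  squared chord, and along the segment the chord is at least half of \<open>chord y a\<close>,
  whence 16.\<close>

lemma one_sided_fejer_diff_le:
  assumes "n \<ge> 1" "r > 0" "chord y a \<ge> 2 * r" "\<bar>t - a\<bar> \<le> r"
  shows "norm (one_sided_fejer n (y - t) - one_sided_fejer n (y - a)) \<le> 16 * r / (chord y a)\<^sup>2"
proof -
  have c: "chord y a > 0" using assms by linarith
  have "norm (one_sided_fejer n (y - t) - one_sided_fejer n (y - a)) \<le> 16 / (chord y a)\<^sup>2 * \<bar>(y - t) - (y - a)\<bar>"
  proof (rule norm_diff_le_of_vector_derivative[OF one_sided_fejer_deriv])
    fix x assume x: "x \<in> closed_segment (y - t) (y - a)"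
    define S where "S = (\<Sum>l=1..n. of_real (real l * (1 - real l / real n)) * cis (real l * x))"
    \<comment> \<open>The point \<open>y - x\<close> lies between \<open>t\<close> and
      \<open>a\<close>, so it stays within \<open>r\<close> of \<open>a\<close>.\<close>
    have "\<bar>(y - x) - a\<bar> \<le> r" using x assms(4) by (auto simp: closed_segment_eq_real_ivl split: if_splits)
    then have "chord (y - x) a \<le> r" using chord_le[of "y - x" a] by linarith
    then have "chord y (y - x) \<ge> chord y a / 2"
      using chord_triangle[of y a "y - x"] assms(3) by linarith
    then have "norm (1 - cis x) \<ge> chord y a / 2" using one_minus_cis[of y "y - x"] by simp
    then have "(chord y a / 2)\<^sup>2 \<le> (norm (1 - cis x))\<^sup>2" using c by (intro power_mono) auto
    then have "(chord y a / 2)\<^sup>2 * norm S \<le> (norm (1 - cis x))\<^sup>2 * norm S" by (intro mult_right_mono) auto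
    also have "\<dots> \<le> 4" unfolding S_def using assms(1) by (rule one_sided_fejer_deriv_le)
    finally have "norm S \<le> 16 / (chord y a)\<^sup>2" using c by (simp add: field_simps power2_eq_square)
    then show "norm (\<i> * S) \<le> 16 / (chord y a)\<^sup>2" by (simp add: norm_mult)
  qed
  also have "\<dots> \<le> 16 / (chord y a)\<^sup>2 * r" using assms(4) by (intro mult_left_mono) auto
  finally show ?thesis by simp
qed

section \<open>The two-sided Fejer kernel\<close>

definition fejer_kernel :: "nat \<Rightarrow> real \<Rightarrow> complex" where
  "fejer_kernel m u = (\<Sum>j\<le>m. \<Sum>k\<in>{- int j..int j}. cis (of_int k * u)) / of_nat (m + 1)"

lemma symmetric_interval_Suc:
  "{- int (Suc j)..int (Suc j)} = insert (int (Suc j)) (insert (- int (Suc j)) {- int j..int j})"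
  by auto

text \<open>A telescoping sum. The product form, instead of a quotient, needs no separate case for
  \<open>cis u = 1\<close>.\<close>

lemma dirichlet_kernel_id:
  "(1 - cis u) * (\<Sum>k\<in>{- int j..int j}. cis (of_int k * u)) = cis (- u) ^ j - cis u ^ (j + 1)"
proof (induction j)
  case (Suc j)
  have c: "cis u * cis (- u) = 1" by (simp add: cis_mult)
  have "(\<Sum>k\<in>{- int (Suc j)..int (Suc j)}. cis (of_int k * u))
     = cis u ^ Suc j + (cis (- u) ^ Suc j + (\<Sum>k\<in>{- int j..int j}. cis (of_int k * u)))"
  proof -
    have "cis (of_int (int (Suc j)) * u) = cis u ^ Suc j" "cis (of_int (- int (Suc j)) * u) = cis (- u) ^ Suc j"
      using Complex.DeMoivre[of u "Suc j"] Complex.DeMoivre[of "- u" "Suc j"] by (simp_all add: algebra_simps)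
    moreover have "int (Suc j) \<notin> insert (- int (Suc j)) {- int j..int j}" "- int (Suc j) \<notin> {- int j..int j}"
      by auto
    ultimately show ?thesis
      unfolding symmetric_interval_Suc by (simp only: sum.insert finite_insert finite_atLeastAtMost_int not_False_eq_True)
  qed
  then have "(1 - cis u) * (\<Sum>k\<in>{- int (Suc j)..int (Suc j)}. cis (of_int k * u))
     = (1 - cis u) * cis u ^ Suc j + (1 - cis u) * cis (- u) ^ Suc j + (cis (- u) ^ j - cis u ^ (j + 1))"
    by (simp only: distrib_left Suc.IH add.assoc)
  also have "\<dots> = cis (- u) ^ Suc j - cis u ^ (Suc j + 1) + cis (- u) ^ j * (1 - cis u * cis (- u))"
    by (simp add: algebra_simps)
  finally show ?case by (simp add: c)
qed (simp add: mult.commute)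

text \<open>A second factor \<open>1 - cis u\<close> makes the sum over \<open>j\<close> of the
  Dirichlet identities telescope as well.\<close>

lemma fejer_kernel_id:
  "(1 - cis u)\<^sup>2 * (\<Sum>j\<le>m. \<Sum>k\<in>{- int j..int j}. cis (of_int k * u))
     = cis (- u) ^ m - 2 * cis u + cis u ^ (m + 2)"
proof (induction m)
  case 0
  then show ?case by (simp add: power2_eq_square algebra_simps)
next
  case (Suc m)
  have c: "cis u * cis (- u) = 1" by (simp add: cis_mult)
  have "(1 - cis u)\<^sup>2 * (\<Sum>j\<le>Suc m. \<Sum>k\<in>{- int j..int j}. cis (of_int k * u))
    = (cis (- u) ^ m - 2 * cis u + cis u ^ (m + 2)) +
      (1 - cis u) * ((1 - cis u) * (\<Sum>k\<in>{- int (Suc m)..int (Suc m)}. cis (of_int k * u)))"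
    unfolding sum.atMost_Suc distrib_left Suc.IH by (simp only: power2_eq_square mult.assoc)
  also have "\<dots> = (cis (- u) ^ Suc m - 2 * cis u + cis u ^ (Suc m + 2)) + cis (- u) ^ m * (1 - cis u * cis (- u))"
    unfolding dirichlet_kernel_id by (simp add: algebra_simps)
  finally show ?case by (simp add: c)
qed

text \<open>Three unimodular terms with coefficients 1, 2, 1 remain after multiplication by
  \<open>(1 - z)\<^sup>2\<close>; hence the 4.\<close>

lemma fejer_kernel_le:
  assumes "chord y t > 0"
  shows "norm (fejer_kernel m (y - t)) \<le> 4 / (real (m + 1) * (chord y t)\<^sup>2)"
proof -
  define S where "S = (\<Sum>j\<le>m. \<Sum>k\<in>{- int j..int j}. cis (of_int k * (y - t)))"
  have "(chord y t)\<^sup>2 * norm S = norm (cis (- (y - t)) ^ m - 2 * cis (y - t) + cis (y - t) ^ (m + 2))"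
    unfolding S_def fejer_kernel_id[symmetric] by (simp add: norm_mult norm_power one_minus_cis)
  also have "\<dots> \<le> (1 + 2) + 1"
    by (intro norm_triangle_le norm_triangle_le_diff add_mono) (auto simp: norm_mult norm_power)
  finally have "norm S \<le> 4 / (chord y t)\<^sup>2" using assms by (simp add: field_simps)
  then have "norm S / real (m + 1) \<le> 4 / (chord y t)\<^sup>2 / real (m + 1)" by (intro divide_right_mono) auto
  then show ?thesis
    unfolding fejer_kernel_def S_def[symmetric] norm_divide norm_of_nat by (simp add: mult.commute)
qed

lemma fourier_sum_cis:
  "fourier_sum n f y = (\<Sum>k\<in>{- int n..int n}. fourier_coeff f k * cis (of_int k * y))"
  by (simp add: fourier_sum_def cis_conv_exp mult.assoc)

lemma fejer_mean_kernel:
  assumes "f \<in> L1"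
  shows "fejer_mean m f y = (LINT t:circle|lebesgue. fejer_kernel m (y - t) * f t) / (2 * of_real pi)"
proof -
  have int: "set_integrable lebesgue circle (\<lambda>t. (\<Sum>k\<in>{- int j..int j}. cis (of_int k * (y - t))) * f t)" for j
  proof (rule set_integrable_mult_bounded)
    show "norm (\<Sum>k\<in>{- int j..int j}. cis (of_int k * (y - t))) \<le> (\<Sum>k\<in>{- int j..int j}. 1)" for t
      by (rule sum_norm_le) simp
  qed (use assms in \<open>auto simp: L1_def intro!: continuous_imp_borel_measurable_lebesgue continuous_intros\<close>)
  have "(LINT t:circle|lebesgue. fejer_kernel m (y - t) * f t)
     = (LINT t:circle|lebesgue. (\<Sum>j\<le>m. (\<Sum>k\<in>{- int j..int j}. cis (of_int k * (y - t))) * f t) / of_nat (m + 1))"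
    by (simp add: fejer_kernel_def sum_distrib_right)
  also have "\<dots> = (\<Sum>j\<le>m. LINT t:circle|lebesgue. (\<Sum>k\<in>{- int j..int j}. cis (of_int k * (y - t))) * f t) / of_nat (m + 1)"
    by (simp only: set_integral_divide_zero set_integral_sum[OF int])
  also have "\<dots> = (\<Sum>j\<le>m. fourier_sum j f y * (2 * of_real pi)) / of_nat (m + 1)"
    using fourier_kernel[OF assms, of _ "\<lambda>_. 1" y] by (simp add: fourier_sum_cis)
  finally show ?thesis
    by (simp add: fejer_mean_def sum_distrib_right[symmetric])
qed

lemma indicator_L1:
  assumes "D \<in> sets lebesgue"
  shows "(indicator D :: real \<Rightarrow> complex) \<in> L1"
  unfolding L1_def mem_Collect_eq
  by (rule set_integrable_bounded[where B = 1]) (use assms in \<open>auto simp: mes_circle indicator_def\<close>)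

text \<open>On the circle the two indicators add up to 1, whose only nonzero coefficient is at
  frequency 0; every partial sum contains that frequency. The set \<open>D\<close> may extend beyond
  the circle, as integration is over the circle only.\<close>

lemma fejer_mean_indicator_compl:
  assumes "D \<in> sets lebesgue"
  shows "fejer_mean m (indicator (circle - D)) y = 1 - fejer_mean m (indicator D) y"
proof -
  have coeff: "fourier_coeff (indicator (circle - D)) k = (if k = 0 then 1 else 0) - fourier_coeff (indicator D) k" for k
  proof -
    have "(LINT t:circle|lebesgue. cis (- of_int k * t) * indicator (circle - D) t)
       = (LINT t:circle|lebesgue. cis (of_int (- k) * t) - cis (- of_int k * t) * indicator D t)"
      by (intro set_lebesgue_integral_cong) (auto simp: indicator_def)
    also have "\<dots> = (LINT t:circle|lebesgue. cis (of_int (- k) * t)) - (LINT t:circle|lebesgue. cis (- of_int k * t) * indicator D t)"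
      by (intro set_integral_diff(2) set_integrable_continuous_circle continuous_intros
            set_integrable_cis_mult indicator_L1 assms)
    finally show ?thesis
      unfolding fourier_coeff_cis integral_cis by (auto simp: diff_divide_distrib)
  qed
  have "fourier_sum j (indicator (circle - D)) y = 1 - fourier_sum j (indicator D) y" for j
  proof -
    have "fourier_sum j (indicator (circle - D)) y
       = (\<Sum>k\<in>{- int j..int j}. (if k = 0 then 1 else 0) - fourier_coeff (indicator D) k * cis (of_int k * y))"
      unfolding fourier_sum_cis coeff by (intro sum.cong) (auto simp: algebra_simps)
    then show ?thesis by (simp add: sum_subtractf fourier_sum_cis)
  qed
  then show ?thesis
    unfolding fejer_mean_def by (simp only: sum_subtractf) (simp add: diff_divide_distrib add.commute del: of_nat_Suc)
qed

section \<open>The difference between partial sums and de la Vallee-Poussin means\<close>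

text \<open>The positive-frequency half of the difference: the de la Vallee-Poussin mean has weight
  1 - l/n at frequency n + l, while the partial sum stops at n.\<close>

definition upper_mean :: "nat \<Rightarrow> (real \<Rightarrow> complex) \<Rightarrow> real \<Rightarrow> complex" where
  "upper_mean n f y =
     (\<Sum>l=1..n. of_real (1 - real l / real n) * (fourier_coeff f (int n + int l) * cis ((real n + real l) * y)))"

lemma fourier_coeff_cnj: "fourier_coeff (\<lambda>t. cnj (f t)) k = cnj (fourier_coeff f (- k))"
proof -
  have "(LINT t:circle|lebesgue. cis (- of_int k * t) * cnj (f t))
      = (LINT t:circle|lebesgue. cnj (cis (of_int k * t) * f t))"
    by (intro set_lebesgue_integral_cong) (auto simp: cis_cnj)
  also have "\<dots> = cnj (LINT t:circle|lebesgue. cis (of_int k * t) * f t)"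
    using Bochner_Integration.integral_cnj[of lebesgue "\<lambda>t. indicator circle t *\<^sub>R (cis (of_int k * t) * f t)"]
    by (simp add: set_lebesgue_integral_def)
  finally show ?thesis by (simp add: fourier_coeff_cis)
qed

text \<open>The term \<open>x l\<close> occurs for exactly those \<open>p\<close> with l \<le> p <
  n.\<close>

lemma sum_partial_sums:
  fixes x :: "nat \<Rightarrow> complex"
  shows "(\<Sum>p<n. \<Sum>l=1..p. x l) = (\<Sum>l=1..n. of_nat (n - l) * x l)"
proof (induction n)
  case (Suc n)
  have "(\<Sum>l=1..Suc n. of_nat (Suc n - l) * x l) = (\<Sum>l=1..n. of_nat (Suc n - l) * x l)" by simp
  also have "\<dots> = (\<Sum>l=1..n. of_nat (n - l) * x l + x l)"
    by (intro sum.cong) (auto simp: Suc_diff_le algebra_simps)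
  finally show ?case using Suc by (simp add: sum.distrib)
qed simp

text \<open>The negative frequencies of \<open>f\<close> are the positive frequencies of its
  conjugate, so a single one-sided kernel suffices for both halves.\<close>

lemma fourier_sum_minus_vp_mean:
  assumes "n \<ge> 1"
  shows "fourier_sum n f y - vp_mean n f y
    = - (upper_mean n f y + cnj (upper_mean n (\<lambda>t. cnj (f t)) y))"
proof -
  define x where "x = (\<lambda>l. fourier_coeff f (int n + int l) * cis ((real n + real l) * y)
     + fourier_coeff f (- (int n + int l)) * cis (- ((real n + real l) * y)))"
  have S: "fourier_sum (n + p) f y = fourier_sum n f y + (\<Sum>l=1..p. x l)" for p
  proof (induction p)
    case (Suc p)
    have "{- int (n + Suc p)..int (n + Suc p)}
       = insert (int (n + Suc p)) (insert (- int (n + Suc p)) {- int (n + p)..int (n + p)})" by auto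
    moreover have "int (n + Suc p) \<notin> insert (- int (n + Suc p)) {- int (n + p)..int (n + p)}"
      "- int (n + Suc p) \<notin> {- int (n + p)..int (n + p)}" by auto
    ultimately have "fourier_sum (n + Suc p) f y
        = fourier_coeff f (int (n + Suc p)) * cis (of_int (int (n + Suc p)) * y)
          + (fourier_coeff f (- int (n + Suc p)) * cis (of_int (- int (n + Suc p)) * y) + fourier_sum (n + p) f y)"
      unfolding fourier_sum_cis by (simp only: sum.insert finite_insert finite_atLeastAtMost_int not_False_eq_True)
    also have "\<dots> = x (Suc p) + fourier_sum (n + p) f y"
      by (simp add: x_def algebra_simps)
    finally show ?case using Suc by simp
  qed simp
  have "(\<Sum>j\<in>{n..<2 * n}. fourier_sum j f y) = (\<Sum>p<n. fourier_sum (n + p) f y)"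
    by (rule sum.reindex_bij_witness[of _ "\<lambda>p. n + p" "\<lambda>j. j - n"]) auto
  also have "\<dots> = of_nat n * fourier_sum n f y + (\<Sum>l=1..n. of_nat (n - l) * x l)"
    by (simp only: S sum.distrib sum_partial_sums) simp
  finally have "vp_mean n f y = fourier_sum n f y + (\<Sum>l=1..n. of_nat (n - l) * x l) / of_nat n"
    using assms by (simp add: vp_mean_def add_divide_distrib)
  moreover have "(\<Sum>l=1..n. of_nat (n - l) * x l) / of_nat n
      = upper_mean n f y + cnj (upper_mean n (\<lambda>t. cnj (f t)) y)"
    unfolding upper_mean_def cnj_sum sum.distrib[symmetric] sum_divide_distrib
  proof (intro sum.cong refl)
    fix l assume "l \<in> {1..n}"
    define w :: complex where "w = of_real (1 - real l / real n)"
    have w: "of_nat (n - l) = of_nat n * w" "cnj w = w"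
      using assms \<open>l \<in> {1..n}\<close> by (simp_all add: w_def of_nat_diff field_simps)
    show "of_nat (n - l) * x l / of_nat n = of_real (1 - real l / real n) * (fourier_coeff f (int n + int l) * cis ((real n + real l) * y)) +
        cnj (of_real (1 - real l / real n) * (fourier_coeff (\<lambda>t. cnj (f t)) (int n + int l) * cis ((real n + real l) * y)))"
      unfolding w_def[symmetric] w(1) x_def using assms w(2) by (simp add: fourier_coeff_cnj cis_cnj distrib_left add_divide_distrib)
  qed
  ultimately show ?thesis by simp
qed

text \<open>Indexed by integers so that \<open>fourier_kernel\<close> and
  \<open>multiplier_L2\<close> apply directly.\<close>

definition one_sided_mean :: "nat \<Rightarrow> (real \<Rightarrow> complex) \<Rightarrow> real \<Rightarrow> complex" where
  "one_sided_mean n f y =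
     (\<Sum>k\<in>{1..int n}. of_real (1 - of_int k / real n) * fourier_coeff f k * cis (of_int k * y))"

text \<open>Multiplying \<open>f\<close> by \<open>cis (- real n * t)\<close> moves frequency n + l
  to l and leaves the modulus of \<open>f\<close> alone, so the stopping intervals stay the same for
  every degree.\<close>

lemma norm_upper_mean:
  "norm (upper_mean n f y) = norm (one_sided_mean n (\<lambda>t. cis (- real n * t) * f t) y)"
proof -
  have coeff: "fourier_coeff (\<lambda>t. cis (- real n * t) * f t) k = fourier_coeff f (int n + k)" for k
  proof -
    have "cis (- of_int k * t) * (cis (- real n * t) * f t) = cis (- of_int (int n + k) * t) * f t" for t
      by (simp only: mult.assoc[symmetric] cis_mult) (simp add: algebra_simps)
    then show ?thesis unfolding fourier_coeff_cis by (simp only:)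
  qed
  have "upper_mean n f y = (\<Sum>l=1..n. cis (real n * y) * (of_real (1 - real l / real n) * fourier_coeff f (int n + int l) * cis (real l * y)))"
    unfolding upper_mean_def
    by (intro sum.cong refl) (simp add: distrib_right mult.left_commute flip: cis_mult)
  also have "\<dots> = cis (real n * y) * (\<Sum>l=1..n. of_real (1 - real l / real n) * fourier_coeff f (int n + int l) * cis (real l * y))"
    by (simp add: sum_distrib_left)
  also have "(\<Sum>l=1..n. of_real (1 - real l / real n) * fourier_coeff f (int n + int l) * cis (real l * y))
     = one_sided_mean n (\<lambda>t. cis (- real n * t) * f t) y"
    unfolding one_sided_mean_def coeff
    by (rule sum.reindex_bij_witness[of _ nat int]) auto
  finally show ?thesis by (simp add: norm_mult)
qed

lemma one_sided_mean_kernel: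
  assumes "f \<in> L1"
  shows "one_sided_mean n f y = (LINT t:circle|lebesgue. one_sided_fejer n (y - t) * f t) / (2 * of_real pi)"
proof -
  have "one_sided_fejer n u = (\<Sum>k\<in>{1..int n}. of_real (1 - of_int k / real n) * cis (of_int k * u))" for u
    unfolding one_sided_fejer_def
    by (rule sum.reindex_bij_witness[of _ nat int]) auto
  then show ?thesis
    unfolding one_sided_mean_def by (subst fourier_kernel[OF assms]) auto
qed

lemma one_sided_mean_L2:
  fixes g :: "real \<Rightarrow> complex"
  assumes "g \<in> borel_measurable lebesgue" "\<And>t. norm (g t) \<le> B"
  shows "(LINT t:circle|lebesgue. (norm (one_sided_mean n g t))\<^sup>2) \<le> (LINT t:circle|lebesgue. (norm (g t))\<^sup>2)"
  unfolding one_sided_mean_def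
proof (rule multiplier_L2[OF assms])
  fix k assume "k \<in> {1..int n}"
  then show "0 \<le> 1 - of_int k / real n \<and> 1 - of_int k / real n \<le> 1"
    by (simp add: divide_le_eq)
qed simp

lemma continuous_one_sided_mean: "continuous_on S (one_sided_mean n f)"
  unfolding one_sided_mean_def[abs_def] by (intro continuous_intros)

lemma one_sided_mean_diff:
  assumes "f \<in> L1" "g \<in> L1"
  shows "one_sided_mean n (\<lambda>t. f t - g t) y = one_sided_mean n f y - one_sided_mean n g y"
proof -
  have *: "fourier_coeff (\<lambda>t. f t - g t) k = fourier_coeff f k - fourier_coeff g k" for k
    unfolding fourier_coeff_cis right_diff_distrib
    by (simp only: set_integral_diff(2) set_integrable_cis_mult assms diff_divide_distrib)
  show ?thesis
    unfolding one_sided_mean_def * sum_subtractf[symmetric] by (intro sum.cong refl) (simp add: algebra_simps)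
qed

section \<open>Dyadic intervals and stopping intervals\<close>

text \<open>Membership becomes an equation between integers, so that nesting and covering reduce to
  arithmetic of floors.\<close>

lemma mem_dyadic_iff:
  "t \<in> {- pi + 2 * pi * real k / 2 ^ n ..< - pi + 2 * pi * (real k + 1) / 2 ^ n}
    \<longleftrightarrow> \<lfloor>(t + pi) / (2 * pi) * 2 ^ n\<rfloor> = int k"
  by (simp add: floor_eq_iff field_simps)

lemma dyadic_levelE:
  assumes "I \<in> dyadic_level n"
  obtains k where "k < 2 ^ n" "I = {- pi + 2 * pi * real k / 2 ^ n ..< - pi + 2 * pi * (real k + 1) / 2 ^ n}"
    "\<And>t. t \<in> I \<longleftrightarrow> \<lfloor>(t + pi) / (2 * pi) * 2 ^ n\<rfloor> = int k"
proof -
  from assms obtain k where k: "k < 2 ^ n"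
    "I = {- pi + 2 * pi * real k / 2 ^ n ..< - pi + 2 * pi * (real k + 1) / 2 ^ n}"
    unfolding dyadic_level_def by auto
  show ?thesis by (rule that[OF k]) (simp only: k(2) mem_dyadic_iff)
qed

lemma finite_dyadic_level: "finite (dyadic_level n)"
  unfolding dyadic_level_def by simp

lemma dyadic_level_nested:
  assumes "I \<in> dyadic_level n" "J \<in> dyadic_level m" "n \<le> m" "t \<in> I" "t \<in> J"
  shows "J \<subseteq> I"
proof
  fix s assume s: "s \<in> J"
  obtain k where k: "\<And>t. t \<in> I \<longleftrightarrow> \<lfloor>(t + pi) / (2 * pi) * 2 ^ n\<rfloor> = int k"
    using dyadic_levelE[OF assms(1)] by metis
  obtain l where l: "\<And>t. t \<in> J \<longleftrightarrow> \<lfloor>(t + pi) / (2 * pi) * 2 ^ m\<rfloor> = int l"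
    using dyadic_levelE[OF assms(2)] by metis
  \<comment> \<open>The coarse index is a function of the fine one, so all points of
    \<open>J\<close> share the index of the common point.\<close>
  have "\<lfloor>x * 2 ^ n\<rfloor> = \<lfloor>x * 2 ^ m\<rfloor> div 2 ^ (m - n)" for x :: real
  proof -
    have "x * 2 ^ n = x * 2 ^ m / of_int (2 ^ (m - n))"
      using assms(3) by (simp add: field_simps flip: power_add)
    then show ?thesis by (simp only:) (subst floor_divide_real_eq_div, simp_all)
  qed
  then show "s \<in> I" using s assms(4,5) unfolding k l by metis
qed

lemma dyadic_level_props:
  assumes "I \<in> dyadic_level n"
  shows dyadic_level_mes: "mes I = 2 * pi / 2 ^ n" and dyadic_level_lmeasurable: "I \<in> lmeasurable"
    and dyadic_level_subset: "I \<subseteq> circle" and dyadic_level_Inf: "Inf I \<in> I"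
    and dyadic_level_dist: "t \<in> I \<Longrightarrow> \<bar>t - Inf I\<bar> \<le> mes I"
proof -
  obtain k where k: "k < 2 ^ n" "I = {- pi + 2 * pi * real k / 2 ^ n ..< - pi + 2 * pi * (real k + 1) / 2 ^ n}"
    using dyadic_levelE[OF assms] by metis
  have lt: "- pi + 2 * pi * real k / 2 ^ n < - pi + 2 * pi * (real k + 1) / 2 ^ n"
    by (simp add: divide_strict_right_mono)
  show m: "mes I = 2 * pi / 2 ^ n"
    using lt unfolding k by (simp add: diff_divide_distrib[symmetric] algebra_simps)
  have Inf: "Inf I = - pi + 2 * pi * real k / 2 ^ n" using lt unfolding k by (rule cInf_atLeastLessThan)
  show "Inf I \<in> I" unfolding Inf using lt unfolding k by simp
  show "\<bar>t - Inf I\<bar> \<le> mes I" if "t \<in> I"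
    unfolding Inf m using that unfolding k by (simp add: algebra_simps add_divide_distrib)
  show "I \<in> lmeasurable" unfolding k by (intro bounded_set_imp_lmeasurable) auto
  have "real k + 1 \<le> 2 ^ n" using k(1) by (metis Suc_leI of_nat_Suc of_nat_le_iff of_nat_numeral of_nat_power add.commute)
  then have "(real k + 1) / 2 ^ n \<le> 1" by simp
  then have "2 * pi * ((real k + 1) / 2 ^ n) \<le> 2 * pi" by (intro mult_left_le) auto
  moreover have "0 \<le> 2 * pi * real k / 2 ^ n" by simp
  ultimately show "I \<subseteq> circle" unfolding k circle_def by (auto simp del: zero_le_divide_iff)
qed

lemma dyadic_level_cover:
  assumes "t \<in> circle" obtains I where "I \<in> dyadic_level n" "t \<in> I"
proof -
  define x where "x = (t + pi) / (2 * pi)"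
  define k where "k = nat \<lfloor>x * 2 ^ n\<rfloor>"
  have x: "0 \<le> x" "x < 1" using assms by (auto simp: x_def circle_def)
  then have k: "int k = \<lfloor>x * 2 ^ n\<rfloor>" by (simp add: k_def)
  have "x * 2 ^ n < 1 * 2 ^ n" using x by (intro mult_strict_right_mono) auto
  then have "\<lfloor>x * 2 ^ n\<rfloor> < 2 ^ n" by (simp add: floor_less_iff)
  then have "k < 2 ^ n" using k by (metis of_nat_less_iff of_nat_numeral of_nat_power)
  show ?thesis
  proof (rule that)
    show "{- pi + 2 * pi * real k / 2 ^ n ..< - pi + 2 * pi * (real k + 1) / 2 ^ n} \<in> dyadic_level n"
      using \<open>k < 2 ^ n\<close> unfolding dyadic_level_def by blast
    show "t \<in> {- pi + 2 * pi * real k / 2 ^ n ..< - pi + 2 * pi * (real k + 1) / 2 ^ n}"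
      unfolding mem_dyadic_iff k x_def ..
  qed
qed

lemma circle_dyadic_level_0: "I \<in> dyadic_level 0 \<longleftrightarrow> I = circle"
  by (auto simp: dyadic_level_def circle_def)

lemma dyadic_level_unique: "I \<in> dyadic_level n \<Longrightarrow> I \<in> dyadic_level m \<Longrightarrow> n = m"
  using dyadic_level_mes[of I n] dyadic_level_mes[of I m] by simp

lemma dyadicE:
  assumes "I \<in> dyadic" obtains n where "I \<in> dyadic_level n"
  using assms by (auto simp: dyadic_def)

lemma countable_dyadic: "countable dyadic"
  unfolding dyadic_def by (auto intro: countable_finite finite_dyadic_level)

section \<open>Stopping intervals up to a finite dyadic level\<close>

definition stopping_upto :: "(real \<Rightarrow> complex) \<Rightarrow> real \<Rightarrow> nat \<Rightarrow> real set set" where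
  "stopping_upto f lam K = stopping f lam \<inter> (\<Union>k\<le>K. dyadic_level k)"

text \<open>Together with the stopping intervals up to level \<open>K\<close> these tile the circle,
  because dyadic intervals are nested or disjoint. Their small averages play the part of the
  pointwise bound of \<open>f\<close> off the stopping intervals.\<close>

definition leftover :: "(real \<Rightarrow> complex) \<Rightarrow> real \<Rightarrow> nat \<Rightarrow> real set set" where
  "leftover f lam K = {J \<in> dyadic_level K. \<forall>I\<in>stopping_upto f lam K. \<not> J \<subseteq> I}"

lemma finite_stopping_upto: "finite (stopping_upto f lam K)"
  unfolding stopping_upto_def using finite_dyadic_level by auto

lemma stopping_upto_mono: "K \<le> L \<Longrightarrow> stopping_upto f lam K \<subseteq> stopping_upto f lam L"
  unfolding stopping_upto_def by (auto intro: order_trans)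

lemma stopping_dyadic: "I \<in> stopping f lam \<Longrightarrow> I \<in> dyadic"
  by (simp add: stopping_def)

lemma stopping_in_upto: "I \<in> stopping f lam \<Longrightarrow> \<exists>K. I \<in> stopping_upto f lam K"
  using stopping_dyadic[of I f lam] unfolding stopping_upto_def by (auto elim!: dyadicE)

lemma stopping_cong:
  assumes "\<And>t. norm (f t) = norm (g t)" shows "stopping f lam = stopping g lam"
  unfolding stopping_def by (simp add: assms)

text \<open>Dyadic intervals that meet are nested, and a proper inclusion would violate the
  maximality of the smaller one.\<close>

lemma stopping_eq:
  assumes "I \<in> stopping f lam" "J \<in> stopping f lam" "t \<in> I" "t \<in> J"
  shows "I = J"
proof -
  obtain n where n: "I \<in> dyadic_level n" using assms(1) stopping_dyadic dyadicE by blast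
  obtain m where m: "J \<in> dyadic_level m" using assms(2) stopping_dyadic dyadicE by blast
  have "I \<subseteq> J \<or> J \<subseteq> I"
  proof (cases "n \<le> m")
    case True
    then show ?thesis using dyadic_level_nested[OF n m _ assms(3,4)] by simp
  next
    case False
    then show ?thesis using dyadic_level_nested[OF m n _ assms(4,3)] by simp
  qed
  moreover have "\<not> A \<subset> B" if "A \<in> stopping f lam" "B \<in> stopping f lam" for A B
    using that unfolding stopping_def by (auto simp: not_le[symmetric])
  ultimately show ?thesis using assms(1,2) by (auto simp: psubset_eq)
qed

lemma dyadic_subset: "I \<in> dyadic \<Longrightarrow> I \<subseteq> circle"
  by (metis dyadicE dyadic_level_subset)

lemma dyadic_sets: "I \<in> dyadic \<Longrightarrow> I \<in> sets lebesgue"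
  by (metis dyadicE dyadic_level_lmeasurable fmeasurableD)

lemma set_integrable_norm_subset:
  assumes "f \<in> L1" "A \<subseteq> circle" "A \<in> sets lebesgue"
  shows "set_integrable lebesgue A (\<lambda>t. norm (f t))"
  using assms set_integrable_norm[of lebesgue circle f] by (auto simp: L1_def intro: set_integrable_subset)

lemma set_integral_norm_subset:
  fixes f :: "real \<Rightarrow> complex"
  assumes "set_integrable lebesgue B f" "A \<subseteq> B" "A \<in> sets lebesgue"
  shows "(LINT t:A|lebesgue. norm (f t)) \<le> (LINT t:B|lebesgue. norm (f t))"
  unfolding set_lebesgue_integral_def
proof (rule integral_mono)
  show "integrable lebesgue (\<lambda>x. indicat_real A x *\<^sub>R norm (f x))"
    using set_integrable_norm[OF assms(1)] assms set_integrable_subset unfolding set_integrable_def[symmetric] by blast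
  show "integrable lebesgue (\<lambda>x. indicat_real B x *\<^sub>R norm (f x))"
    using set_integrable_norm[OF assms(1)] unfolding set_integrable_def .
qed (use assms(2) in \<open>auto simp: indicator_def\<close>)

lemma set_integrable_dyadic:
  "f \<in> L1 \<Longrightarrow> I \<in> dyadic \<Longrightarrow> set_integrable lebesgue I f"
  using dyadic_subset[of I] dyadic_sets[of I] set_integrable_subset[of lebesgue circle f I]
  by (simp add: L1_def)

lemma sum_set_integral_disjoint:
  fixes g :: "real \<Rightarrow> 'a::{banach, second_countable_topology}"
  assumes "finite Q" "Q \<subseteq> dyadic" "disjoint Q" "set_integrable lebesgue (\<Union>Q) g"
  shows "(LINT t:\<Union>Q|lebesgue. g t) = (\<Sum>q\<in>Q. LINT t:q|lebesgue. g t)"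
proof -
  have "(LINT t:(\<Union>q\<in>Q. id q)|lebesgue. g t) = (\<Sum>q\<in>Q. LINT t:id q|lebesgue. g t)"
    using assms dyadic_sets
    by (intro set_integral_finite_Union)
       (auto simp: disjoint_family_on_def disjoint_def intro!: set_integrable_subset[of lebesgue "\<Union>Q"])
  then show ?thesis by simp
qed

lemma norm1_nonneg: "norm1 f \<ge> 0"
  unfolding norm1_def set_lebesgue_integral_def by (intro integral_nonneg_AE AE_I2) auto

context
  fixes f :: "real \<Rightarrow> complex" and lam :: real
  assumes f: "f \<in> L1" and lam: "lam > norm1 f / (2 * pi)"
begin

lemma lam_pos: "lam > 0"
  using lam norm1_nonneg[of f] by (meson divide_nonneg_pos le_less_trans mult_pos_pos pi_gt_zero zero_less_numeral)

lemma stopping_integral_gt: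
  assumes "I \<in> stopping f lam"
  shows "lam * mes I < (LINT t:I|lebesgue. norm (f t))"
proof -
  obtain n where "I \<in> dyadic_level n" using assms stopping_dyadic dyadicE by blast
  then have "mes I > 0" by (simp add: dyadic_level_mes)
  then show ?thesis using assms by (simp add: stopping_def field_simps)
qed

text \<open>The dyadic parent has twice the length and, by maximality, average at most
  \<open>lam\<close>.\<close>

lemma stopping_integral_le:
  assumes "I \<in> stopping f lam"
  shows "(LINT t:I|lebesgue. norm (f t)) \<le> 2 * lam * mes I"
proof -
  obtain n where n: "I \<in> dyadic_level n" using assms stopping_dyadic dyadicE by blast
  show ?thesis
  proof (cases n)
    \<comment> \<open>The whole circle has no parent, but it cannot be a stopping interval, as
      \<open>lam\<close> exceeds its average.\<close>
    case 0
    then have "I = circle" using n by (simp add: circle_dyadic_level_0)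
    then show ?thesis
      using stopping_integral_gt[OF assms] lam by (simp add: norm1_def[symmetric] mes_circle field_simps)
  next
    case (Suc m)
    obtain P where P: "P \<in> dyadic_level m" "Inf I \<in> P"
      using dyadic_level_cover[of "Inf I" m] dyadic_level_subset[OF n] dyadic_level_Inf[OF n] by blast
    have sub: "I \<subseteq> P"
      using dyadic_level_nested[OF P(1) n _ P(2) dyadic_level_Inf[OF n]] Suc by simp
    have "I \<noteq> P" using dyadic_level_unique[OF n, of m] P(1) Suc by auto
    moreover have "P \<in> dyadic" using P(1) by (auto simp: dyadic_def)
    ultimately have "(LINT t:P|lebesgue. norm (f t)) / mes P \<le> lam"
      using assms sub by (auto simp: stopping_def)
    moreover have "mes P = 2 * mes I" "mes P > 0"
      using dyadic_level_mes[OF P(1)] dyadic_level_mes[OF n] Suc by auto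
    ultimately have "(LINT t:P|lebesgue. norm (f t)) \<le> 2 * lam * mes I"
      by (simp add: divide_le_eq mult.commute mult.left_commute)
    moreover have "(LINT t:I|lebesgue. norm (f t)) \<le> (LINT t:P|lebesgue. norm (f t))"
      by (rule set_integral_norm_subset[OF set_integrable_dyadic[OF f \<open>P \<in> dyadic\<close>] sub])
         (use assms stopping_dyadic dyadic_sets in blast)
    ultimately show ?thesis by linarith
  qed
qed

text \<open>The weak-type estimate for the dyadic maximal function: the intervals are disjoint and
  each carries more than \<open>lam * mes I\<close> of the integral of |f|.\<close>

lemma sum_mes_stopping_upto: "(\<Sum>I\<in>stopping_upto f lam K. mes I) \<le> norm1 f / lam"
proof -
  have sub: "stopping_upto f lam K \<subseteq> stopping f lam" by (auto simp: stopping_upto_def)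
  have dy: "stopping_upto f lam K \<subseteq> dyadic" using sub stopping_dyadic by blast
  have c: "\<Union>(stopping_upto f lam K) \<subseteq> circle"
    using dy dyadic_subset by blast
  have dis: "disjoint (stopping_upto f lam K)"
    using sub stopping_eq by (fastforce simp: disjoint_def)
  have s: "\<Union>(stopping_upto f lam K) \<in> sets lebesgue"
    using dy dyadic_sets finite_stopping_upto by (intro sets.finite_Union) auto
  have "lam * (\<Sum>I\<in>stopping_upto f lam K. mes I) \<le> (\<Sum>I\<in>stopping_upto f lam K. LINT t:I|lebesgue. norm (f t))"
    unfolding sum_distrib_left using sub stopping_integral_gt by (intro sum_mono) (auto intro: less_imp_le)
  also have "\<dots> = (LINT t:\<Union>(stopping_upto f lam K)|lebesgue. norm (f t))"
    by (intro sum_set_integral_disjoint[symmetric] finite_stopping_upto dy dis set_integrable_norm_subset f c s)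
  also have "\<dots> \<le> norm1 f"
    unfolding norm1_def using f by (intro set_integral_norm_subset c s) (simp add: L1_def)
  finally show ?thesis using lam_pos by (simp add: pos_le_divide_eq mult.commute)
qed

text \<open>If the average were above \<open>lam\<close>, the largest dyadic interval containing
  \<open>J\<close> with average above \<open>lam\<close> would be a stopping interval of level at
  most \<open>K\<close>.\<close>

lemma leftover_integral_le:
  assumes "J \<in> leftover f lam K"
  shows "(LINT t:J|lebesgue. norm (f t)) \<le> lam * mes J"
proof (rule ccontr)
  assume not: "\<not> ?thesis"
  define P where "P = (\<lambda>k. \<exists>I\<in>dyadic_level k. J \<subseteq> I \<and> (LINT t:I|lebesgue. norm (f t)) / mes I > lam)"
  have J: "J \<in> dyadic_level K" using assms by (simp add: leftover_def)
  have "mes J > 0" using dyadic_level_mes[OF J] by simp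
  then have PK: "P K" unfolding P_def using J not by (auto intro!: bexI[of _ J] simp: field_simps)
  define k where "k = (LEAST k. P k)"
  have "P k" "k \<le> K" unfolding k_def using PK by (auto intro: LeastI Least_le)
  then obtain I where I: "I \<in> dyadic_level k" "J \<subseteq> I" "(LINT t:I|lebesgue. norm (f t)) / mes I > lam"
    by (auto simp: P_def)
  have "I \<in> stopping f lam"
    unfolding stopping_def
  proof (intro CollectI conjI ballI impI)
    fix I' assume I': "I' \<in> dyadic" "I \<subset> I'"
    then obtain k' where k': "I' \<in> dyadic_level k'" by (auto elim: dyadicE)
    have "k' < k"
    proof (rule ccontr)
      assume "\<not> k' < k"
      then have "I' \<subseteq> I"
        using dyadic_level_nested[OF I(1) k', of "Inf I"] dyadic_level_Inf[OF I(1)] I'(2) by auto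
      then show False using I'(2) by auto
    qed
    then have "\<not> P k'" unfolding k_def by (rule not_less_Least)
    then show "(LINT t:I'|lebesgue. norm (f t)) / mes I' \<le> lam"
      using k' I(2) I'(2) by (fastforce simp: P_def)
  qed (use I in \<open>auto simp: dyadic_def\<close>)
  then have "I \<in> stopping_upto f lam K" using I(1) \<open>k \<le> K\<close> by (auto simp: stopping_upto_def)
  then show False using assms I(2) by (auto simp: leftover_def)
qed

lemma cz_partition:
  defines "Q \<equiv> \<lambda>K. stopping_upto f lam K \<union> leftover f lam K"
  shows "finite (Q K)" "Q K \<subseteq> dyadic" "disjoint (Q K)" "\<Union>(Q K) = circle"
    "stopping_upto f lam K \<inter> leftover f lam K = {}"
    "\<And>q. q \<in> Q K \<Longrightarrow> (LINT t:q|lebesgue. norm (f t)) \<le> 2 * lam * mes q"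
proof -
  have l: "leftover f lam K \<subseteq> dyadic_level K" by (auto simp: leftover_def)
  show "finite (Q K)" unfolding Q_def
    using finite_stopping_upto l finite_dyadic_level finite_subset by blast
  show dy: "Q K \<subseteq> dyadic" unfolding Q_def
    using l by (auto simp: dyadic_def stopping_upto_def)
  show "stopping_upto f lam K \<inter> leftover f lam K = {}" by (auto simp: leftover_def)
  have SL: "I \<inter> J = {}" if IJ: "I \<in> stopping_upto f lam K" "J \<in> leftover f lam K" for I J
  proof (rule ccontr)
    assume "I \<inter> J \<noteq> {}"
    then obtain t where "t \<in> I" "t \<in> J" by auto
    moreover obtain k where "I \<in> dyadic_level k" "k \<le> K" using IJ(1) by (auto simp: stopping_upto_def)
    moreover have "J \<in> dyadic_level K" using IJ(2) l by blast
    ultimately have "J \<subseteq> I" using dyadic_level_nested by blast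
    then show False using IJ by (auto simp: leftover_def)
  qed
  show "disjoint (Q K)"
  proof (rule disjointI)
    fix a b assume ab: "a \<in> Q K" "b \<in> Q K" "a \<noteq> b"
    have "a = b" if "a \<in> stopping_upto f lam K" "b \<in> stopping_upto f lam K" "t \<in> a" "t \<in> b" for t
      by (rule stopping_eq[of a f lam b t]) (use that in \<open>auto simp: stopping_upto_def\<close>)
    moreover have "a = b" if "a \<in> leftover f lam K" "b \<in> leftover f lam K" "t \<in> a" "t \<in> b" for t
    proof (rule antisym)
      have "a \<in> dyadic_level K" "b \<in> dyadic_level K" using that l by auto
      then show "a \<subseteq> b" "b \<subseteq> a"
        using dyadic_level_nested[of b K a K t] dyadic_level_nested[of a K b K t] that by auto
    qed
    ultimately show "a \<inter> b = {}" using ab SL unfolding Q_def by blast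
  qed
  show "\<Union>(Q K) = circle"
  proof
    show "\<Union>(Q K) \<subseteq> circle" using dy dyadic_subset by blast
    show "circle \<subseteq> \<Union>(Q K)"
    proof
      fix t assume "t \<in> circle"
      then obtain J where "J \<in> dyadic_level K" "t \<in> J" by (rule dyadic_level_cover)
      \<comment> \<open>The level-\<open>K\<close> interval of \<open>t\<close> is itself leftover
        unless a stopping interval contains it.\<close>
      then show "t \<in> \<Union>(Q K)" unfolding Q_def leftover_def by blast
    qed
  qed
  fix q assume "q \<in> Q K"
  then consider "q \<in> stopping f lam" | "q \<in> leftover f lam K"
    by (auto simp: Q_def stopping_upto_def)
  then show "(LINT t:q|lebesgue. norm (f t)) \<le> 2 * lam * mes q"
  proof cases
    case 1
    then show ?thesis by (rule stopping_integral_le)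
  next
    case 2
    then have "(LINT t:q|lebesgue. norm (f t)) \<le> lam * mes q" by (rule leftover_integral_le)
    also have "\<dots> \<le> 2 * lam * mes q" using lam_pos by (intro mult_right_mono) auto
    finally show ?thesis .
  qed
qed

end

section \<open>The Calderon-Zygmund decomposition\<close>

lemma one_sided_fejer_bounded: "norm (one_sided_fejer n u) \<le> real n"
proof -
  have "norm (one_sided_fejer n u) \<le> (\<Sum>l=1..n. 1)"
    unfolding one_sided_fejer_def
  proof (rule sum_norm_le)
    fix l assume "l \<in> {1..n}"
    then have "0 \<le> 1 - real l / real n" "1 - real l / real n \<le> 1" by auto
    then show "norm (of_real (1 - real l / real n) * cis (real l * u)) \<le> 1"
      by (simp only: norm_mult norm_cis norm_of_real) simp
  qed
  then show ?thesis by simp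
qed

lemma continuous_one_sided_fejer: "continuous_on S (\<lambda>t. one_sided_fejer n (y - t))"
  unfolding one_sided_fejer_def by (intro continuous_intros)

lemma set_integral_const_lmeasurable:
  fixes c :: "'b::{banach, second_countable_topology}"
  assumes "A \<in> lmeasurable"
  shows "(LINT t:A|lebesgue. c) = mes A *\<^sub>R c"
  using assms by (intro set_integral_const) (auto simp: fmeasurable_def)

definition average :: "(real \<Rightarrow> complex) \<Rightarrow> real set \<Rightarrow> complex" where
  "average f q = (LINT t:q|lebesgue. f t) / of_real (mes q)"

lemma norm_average_le:
  assumes "set_integrable lebesgue q f" "mes q > 0"
  shows "norm (average f q) * mes q \<le> (LINT t:q|lebesgue. norm (f t))"
  using set_integral_norm_bound[OF assms(1)] assms(2) by (simp add: average_def norm_divide)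

text \<open>Since \<open>f - average f q\<close> has integral 0 over \<open>q\<close>, any constant
  may be subtracted from the kernel \<open>h\<close>. The 2 arises because the average adds at most
  another integral of |f|.\<close>

lemma norm_integral_cancel_le:
  assumes "q \<in> lmeasurable" "mes q > 0" "set_integrable lebesgue q f"
    and "continuous_on UNIV h" "\<And>t. norm (h t) \<le> A" and B: "\<And>t. t \<in> q \<Longrightarrow> norm (h t - c) \<le> B"
  shows "norm (LINT t:q|lebesgue. h t * (f t - average f q)) \<le> 2 * B * (LINT t:q|lebesgue. norm (f t))"
proof -
  define a where "a = average f q"
  have ic: "set_integrable lebesgue q (\<lambda>t. b)" for b :: "'b::euclidean_space"
    using assms(1) by (intro set_integrable_bounded[where B = "norm b"]) auto
  have i1: "set_integrable lebesgue q (\<lambda>t. f t - a)"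
    by (intro set_integral_diff(1) assms(3) ic)
  have i2: "set_integrable lebesgue q (\<lambda>t. h t * (f t - a))"
    using assms(4,5) by (intro set_integrable_mult_bounded[OF i1] continuous_imp_borel_measurable_lebesgue)
  have "(LINT t:q|lebesgue. f t - a) = (LINT t:q|lebesgue. f t) - (LINT t:q|lebesgue. a)"
    by (intro set_integral_diff(2) assms(3) ic)
  also have "\<dots> = 0"
  proof -
    have "(LINT t:q|lebesgue. a) = of_real (mes q) * a"
      using assms(1) by (simp add: set_integral_const_lmeasurable scaleR_conv_of_real)
    then show ?thesis using assms(2) by (simp add: a_def average_def)
  qed
  finally have "(LINT t:q|lebesgue. h t * (f t - a)) = (LINT t:q|lebesgue. h t * (f t - a) - c * (f t - a))"
    using set_integral_diff(2)[OF i2 set_integrable_mult_right[OF i1]] by (simp add: set_integral_mult_right)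
  also have "norm \<dots> \<le> (LINT t:q|lebesgue. norm (h t * (f t - a) - c * (f t - a)))"
    by (intro set_integral_norm_bound set_integral_diff(1) i2 set_integrable_mult_right i1)
  also have "\<dots> \<le> (LINT t:q|lebesgue. B * (norm (f t) + norm a))"
  proof (rule set_integral_mono)
    show "set_integrable lebesgue q (\<lambda>t. norm (h t * (f t - a) - c * (f t - a)))"
      by (intro set_integrable_norm set_integral_diff(1) i2 set_integrable_mult_right i1)
    show "set_integrable lebesgue q (\<lambda>t. B * (norm (f t) + norm a))"
      by (intro set_integrable_mult_right set_integral_add(1) set_integrable_norm assms(3) ic)
    fix t assume "t \<in> q"
    then have "norm (h t - c) * norm (f t - a) \<le> B * (norm (f t) + norm a)"
      using B[of t] norm_triangle_ineq4[of "f t" a] order_trans[OF norm_ge_zero B[of t]] by (intro mult_mono) auto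
    then show "norm (h t * (f t - a) - c * (f t - a)) \<le> B * (norm (f t) + norm a)"
      by (simp add: norm_mult flip: left_diff_distrib)
  qed
  also have "\<dots> = B * ((LINT t:q|lebesgue. norm (f t)) + norm a * mes q)"
    using assms(1) set_integral_add(2)[OF set_integrable_norm[OF assms(3)] ic[of "norm a"]]
    by (simp add: set_integral_const_lmeasurable)
  \<comment> \<open>The sign of \<open>B\<close> is read off from a point of \<open>q\<close>; an
    empty \<open>q\<close> is excluded by its positive measure.\<close>
  also have "\<dots> \<le> B * ((LINT t:q|lebesgue. norm (f t)) + (LINT t:q|lebesgue. norm (f t)))"
  proof (cases "q = {}")
    case False
    then obtain t where "t \<in> q" by auto
    then have "B \<ge> 0" using B[of t] norm_ge_zero order_trans by blast
    then show ?thesis using norm_average_le[OF assms(3,2)] by (intro mult_left_mono) (auto simp: a_def)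
  qed (use assms(2) in auto)
  finally show ?thesis by (simp add: a_def)
qed

context
  fixes f :: "real \<Rightarrow> complex" and lam :: real
  assumes f: "f \<in> L1" and lam: "lam > norm1 f / (2 * pi)"
begin

text \<open>The witness is the one-sided mean of the good part of \<open>f\<close>; the multiplier
  bound gives its square integral. The bad part has mean 0 on each tile and contributes at most
  \<open>128 * lam\<close> from stopping intervals and \<open>lam\<close> from leftover
  ones.\<close>

lemma cz_one_sided_mean:
  assumes n: "n \<ge> 1"
  shows "\<exists>g. continuous_on UNIV g \<and> (LINT t:circle|lebesgue. (norm (g t))\<^sup>2) \<le> 2 * lam * norm1 f \<and>
    (\<forall>y\<in>circle. (\<forall>I\<in>stopping f lam. 2 * mes I \<le> chord y (Inf I)) \<and>
        (\<forall>K. (\<Sum>I\<in>stopping_upto f lam K. bump (Inf I) (mes I) y) \<le> 1)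
      \<longrightarrow> norm (one_sided_mean n f y) \<le> 129 * lam + norm (g y :: complex))"
proof -
  note lam_pos = lam_pos[OF f lam]
  \<comment> \<open>The level is so fine that the crude Lipschitz bound on the leftover intervals
    costs at most \<open>lam\<close> in total.\<close>
  obtain K :: nat where K: "4 * pi * (real n)\<^sup>2 * norm1 f / lam < 2 ^ K"
    using real_arch_pow[of 2] by auto
  define S where "S = stopping_upto f lam K"
  define L where "L = leftover f lam K"
  define Q where "Q = S \<union> L"
  note cz = cz_partition[OF f lam, where K = K, folded S_def L_def, folded Q_def]
  have S: "I \<in> S \<Longrightarrow> I \<in> stopping f lam" for I by (simp add: S_def stopping_upto_def)
  have qm: "q \<in> lmeasurable" "mes q > 0" "set_integrable lebesgue q f" "q \<in> sets lebesgue" if qQ: "q \<in> Q" for q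
  proof -
    show "set_integrable lebesgue q f" using cz(2) qQ set_integrable_dyadic[OF f] by auto
    obtain m where "q \<in> dyadic_level m" using cz(2) qQ dyadicE by blast
    then show "q \<in> lmeasurable" "mes q > 0" using dyadic_level_lmeasurable dyadic_level_mes by auto
    then show "q \<in> sets lebesgue" by auto
  qed
  \<comment> \<open>The good part: \<open>f\<close> replaced by its average on each tile.\<close>
  define g where "g = (\<lambda>t. \<Sum>q\<in>Q. indicator q t * average f q)"
  have gq: "g t = average f q" if "q \<in> Q" "t \<in> q" for q t
  proof -
    have "g t = (\<Sum>q'\<in>Q. if q' = q then average f q else 0)"
      unfolding g_def using cz(3) that
      by (intro sum.cong refl) (auto simp: indicator_def disjoint_def)
    then show ?thesis using cz(1) that by simp
  qed
  have g0: "g t = 0" if "t \<notin> circle" for t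
    unfolding g_def using cz(4) that by (intro sum.neutral) (auto simp: indicator_def)
  have av: "norm (average f q) \<le> 2 * lam" if "q \<in> Q" for q
  proof -
    have "norm (average f q) * mes q \<le> 2 * lam * mes q"
      using norm_average_le[OF qm(3)[OF that] qm(2)[OF that]] cz(6)[OF that] by linarith
    then show ?thesis using qm(2)[OF that] by simp
  qed
  have gb: "norm (g t) \<le> 2 * lam" for t
  proof (cases "t \<in> circle")
    case True
    then obtain q where "q \<in> Q" "t \<in> q" using cz(4) by blast
    then show ?thesis using gq av by metis
  qed (use g0 lam_pos in auto)
  have gm: "g \<in> borel_measurable lebesgue"
    unfolding g_def using qm(4)
    by (intro borel_measurable_sum borel_measurable_times borel_measurable_indicator) auto
  have g1: "g \<in> L1"
    unfolding L1_def using gm gb by (auto intro!: set_integrable_bounded simp: mes_circle)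
  \<comment> \<open>One factor |g| is at most \<open>2 * lam\<close>, and averaging does not
    increase the integral of the other.\<close>
  have L2: "(LINT t:circle|lebesgue. (norm (g t))\<^sup>2) \<le> 2 * lam * norm1 f"
  proof -
    have gi: "set_integrable lebesgue circle (\<lambda>t. norm (g t))"
      using g1 set_integrable_norm by (auto simp: L1_def)
    have i2: "set_integrable lebesgue circle (\<lambda>t. (norm (g t))\<^sup>2)"
      using gm power_mono[OF gb norm_ge_zero, of _ 2]
      by (intro set_integrable_bounded[where B = "(2 * lam)\<^sup>2"]) (auto simp: mes_circle)
    have "(LINT t:circle|lebesgue. (norm (g t))\<^sup>2) \<le> (LINT t:circle|lebesgue. 2 * lam * norm (g t))"
      using gb by (intro set_integral_mono i2 set_integrable_mult_right gi) (auto simp: power2_eq_square intro: mult_right_mono)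
    also have "\<dots> = 2 * lam * (LINT t:\<Union>Q|lebesgue. norm (g t))" by (simp add: cz(4))
    also have "(LINT t:\<Union>Q|lebesgue. norm (g t)) = (\<Sum>q\<in>Q. LINT t:q|lebesgue. norm (g t))"
      using gi cz by (intro sum_set_integral_disjoint) auto
    also have "\<dots> = (\<Sum>q\<in>Q. LINT t:q|lebesgue. norm (average f q))"
      using qm by (intro sum.cong refl set_lebesgue_integral_cong) (auto simp: gq)
    also have "\<dots> = (\<Sum>q\<in>Q. norm (average f q) * mes q)"
      using qm(1) by (intro sum.cong refl) (auto simp: set_integral_const_lmeasurable)
    also have "\<dots> \<le> (\<Sum>q\<in>Q. LINT t:q|lebesgue. norm (f t))"
      by (intro sum_mono norm_average_le qm)
    also have "\<dots> = (LINT t:\<Union>Q|lebesgue. norm (f t))"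
      using cz f by (intro sum_set_integral_disjoint[symmetric]) (auto intro: set_integrable_norm_subset)
    finally show ?thesis using lam_pos by (simp add: cz(4) norm1_def)
  qed
  have fg: "(\<lambda>t. f t - g t) \<in> L1" using f g1 by (auto simp: L1_def)
  have "norm (one_sided_mean n f y) \<le> 129 * lam + norm (one_sided_mean n g y)"
    if y: "\<And>I. I \<in> stopping f lam \<Longrightarrow> 2 * mes I \<le> chord y (Inf I)"
      "(\<Sum>I\<in>S. bump (Inf I) (mes I) y) \<le> 1" for y
  proof -
    define h where "h = (\<lambda>t. one_sided_fejer n (y - t))"
    define F where "F = (\<lambda>q. LINT t:q|lebesgue. norm (f t))"
    have hc: "continuous_on UNIV h" unfolding h_def by (rule continuous_one_sided_fejer)
    have hb: "norm (h t) \<le> real n" for t unfolding h_def by (rule one_sided_fejer_bounded)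
    have "(LINT t:circle|lebesgue. h t * (f t - g t)) = (LINT t:\<Union>Q|lebesgue. h t * (f t - g t))"
      by (simp add: cz(4))
    also have "\<dots> = (\<Sum>q\<in>Q. LINT t:q|lebesgue. h t * (f t - g t))"
      using cz fg hb hc unfolding L1_def
      by (intro sum_set_integral_disjoint set_integrable_mult_bounded[where B = "real n"]
           continuous_imp_borel_measurable_lebesgue) auto
    also have "\<dots> = (\<Sum>q\<in>Q. LINT t:q|lebesgue. h t * (f t - average f q))"
      using qm by (intro sum.cong refl set_lebesgue_integral_cong) (auto simp: gq)
    also have "norm \<dots> \<le> (\<Sum>q\<in>Q. norm (LINT t:q|lebesgue. h t * (f t - average f q)))"
      by (rule norm_sum)
    also have "\<dots> = (\<Sum>q\<in>S. norm (LINT t:q|lebesgue. h t * (f t - average f q)))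
       + (\<Sum>q\<in>L. norm (LINT t:q|lebesgue. h t * (f t - average f q)))"
      unfolding Q_def using cz(1,5) by (intro sum.union_disjoint) (auto simp: Q_def)
    \<comment> \<open>The constant 128 collects 2 from cancellation, 16 from the kernel, 2 from the
      average and 2 from \<open>sq_ratio_le_bump\<close>.\<close>
    also have "\<dots> \<le> (\<Sum>q\<in>S. 128 * lam * bump (Inf q) (mes q) y) + (\<Sum>q\<in>L. 4 * pi * (real n)\<^sup>2 / 2 ^ K * F q)"
    proof (intro add_mono sum_mono)
      fix q assume q: "q \<in> S"
      then have qQ: "q \<in> Q" by (simp add: Q_def)
      obtain m where m: "q \<in> dyadic_level m" using cz(2) qQ dyadicE by blast
      define c where "c = chord y (Inf q)"
      have c: "2 * mes q \<le> c" using y(1)[OF S[OF q]] by (simp add: c_def)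
      have pos: "mes q > 0" "c > 0" using qm(2)[OF qQ] c by auto
      have "norm (LINT t:q|lebesgue. h t * (f t - average f q)) \<le> 2 * (16 * mes q / c\<^sup>2) * F q"
        unfolding F_def
      proof (rule norm_integral_cancel_le[OF qm(1)[OF qQ] qm(2)[OF qQ] qm(3)[OF qQ] hc hb])
        fix t assume "t \<in> q"
        then show "norm (h t - one_sided_fejer n (y - Inf q)) \<le> 16 * mes q / c\<^sup>2"
          unfolding h_def c_def using n pos(1) c[unfolded c_def] dyadic_level_dist[OF m]
          by (intro one_sided_fejer_diff_le) auto
      qed
      also have "\<dots> \<le> 2 * (16 * mes q / c\<^sup>2) * (2 * lam * mes q)"
        unfolding F_def using cz(6)[OF qQ] pos by (intro mult_left_mono) auto
      also have "\<dots> = 64 * lam * ((mes q)\<^sup>2 / c\<^sup>2)" by (simp add: power2_eq_square)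
      also have "\<dots> \<le> 64 * lam * (2 * bump (Inf q) (mes q) y)"
        unfolding c_def using pos c lam_pos by (intro mult_left_mono sq_ratio_le_bump) (auto simp: c_def)
      finally show "norm (LINT t:q|lebesgue. h t * (f t - average f q)) \<le> 128 * lam * bump (Inf q) (mes q) y" by simp
    next
      fix q assume q: "q \<in> L"
      then have qQ: "q \<in> Q" and m: "q \<in> dyadic_level K" by (simp_all add: Q_def L_def leftover_def)
      \<comment> \<open>A leftover interval may contain \<open>y\<close>, so the Lipschitz bound is
        used; its length is 2 pi / 2^K.\<close>
      have "norm (LINT t:q|lebesgue. h t * (f t - average f q)) \<le> 2 * ((real n)\<^sup>2 * mes q) * F q"
        unfolding F_def
      proof (rule norm_integral_cancel_le[OF qm(1)[OF qQ] qm(2)[OF qQ] qm(3)[OF qQ] hc hb])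
        fix t assume t: "t \<in> q"
        have "norm (h t - one_sided_fejer n (y - Inf q)) \<le> (real n)\<^sup>2 * \<bar>(y - t) - (y - Inf q)\<bar>"
          unfolding h_def by (rule one_sided_fejer_lipschitz[OF n])
        also have "\<dots> \<le> (real n)\<^sup>2 * mes q"
          using dyadic_level_dist[OF m t] by (intro mult_left_mono) auto
        finally show "norm (h t - one_sided_fejer n (y - Inf q)) \<le> (real n)\<^sup>2 * mes q" .
      qed
      then show "norm (LINT t:q|lebesgue. h t * (f t - average f q)) \<le> 4 * pi * (real n)\<^sup>2 / 2 ^ K * F q"
        by (simp add: dyadic_level_mes[OF m] mult_ac)
    qed
    also have "\<dots> \<le> 128 * lam * 1 + lam"
    proof (rule add_mono)
      show "(\<Sum>q\<in>S. 128 * lam * bump (Inf q) (mes q) y) \<le> 128 * lam * 1"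
        unfolding sum_distrib_left[symmetric] using y(2) lam_pos by (intro mult_left_mono) auto
      have F0: "F q \<ge> 0" for q unfolding F_def set_lebesgue_integral_def by (intro integral_nonneg_AE AE_I2) auto
      have "(\<Sum>q\<in>L. F q) \<le> (\<Sum>q\<in>Q. F q)"
        using cz(1) F0 by (intro sum_mono2) (auto simp: Q_def)
      also have "\<dots> = norm1 f"
        unfolding F_def using sum_set_integral_disjoint[OF cz(1-3), of "\<lambda>t. norm (f t)"] f
        by (simp add: cz(4) norm1_def set_integrable_norm_subset)
      finally have "(\<Sum>q\<in>L. 4 * pi * (real n)\<^sup>2 / 2 ^ K * F q) \<le> 4 * pi * (real n)\<^sup>2 / 2 ^ K * norm1 f"
        unfolding sum_distrib_left[symmetric] by (intro mult_left_mono) auto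
      also have "\<dots> \<le> lam" using K lam_pos by (simp add: field_simps)
      finally show "(\<Sum>q\<in>L. 4 * pi * (real n)\<^sup>2 / 2 ^ K * F q) \<le> lam" .
    qed
    finally have *: "norm (LINT t:circle|lebesgue. h t * (f t - g t)) \<le> 129 * lam" by simp
    have "norm (one_sided_mean n (\<lambda>t. f t - g t) y) = norm (LINT t:circle|lebesgue. h t * (f t - g t)) / (2 * pi)"
      unfolding one_sided_mean_kernel[OF fg] h_def by (simp add: norm_divide norm_mult)
    also have "\<dots> \<le> norm (LINT t:circle|lebesgue. h t * (f t - g t)) / 1"
      using pi_gt3 by (intro divide_left_mono) auto
    finally have "norm (one_sided_mean n (\<lambda>t. f t - g t) y) \<le> 129 * lam" using * by simp
    then show ?thesis
      unfolding one_sided_mean_diff[OF f g1] using norm_triangle_sub[of "one_sided_mean n f y" "one_sided_mean n g y"] by linarith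
  qed
  then show ?thesis
    using L2 one_sided_mean_L2[OF gm gb, of n] continuous_one_sided_mean[of UNIV n g]
    unfolding S_def by (intro exI[of _ "one_sided_mean n g"]) (fastforce)
qed

end

section \<open>Exceptional sets and Fejer means of dilated unions\<close>

lemma integral_circle_indicator:
  assumes "A \<in> lmeasurable" "A \<subseteq> circle"
  shows "(LINT t:circle|lebesgue. c * indicat_real A t) = c * mes A"
proof -
  have "(\<lambda>t. indicat_real circle t *\<^sub>R (c * indicat_real A t)) = (\<lambda>t. c * indicat_real A t)"
    using assms(2) by (auto simp: indicator_def fun_eq_iff)
  then show ?thesis
    using assms(1) unfolding set_lebesgue_integral_def by (simp only: integral_mult_right_zero) simp
qed

lemma markov_circle:
  fixes h :: "real \<Rightarrow> real"
  assumes "continuous_on UNIV h" "\<And>t. 0 \<le> h t" "c > 0"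
  shows "{t \<in> circle. c \<le> h t} \<in> sets lebesgue"
    and "mes {t \<in> circle. c \<le> h t} \<le> (LINT t:circle|lebesgue. h t) / c"
proof -
  define A where "A = {t \<in> circle. c \<le> h t}"
  have "closed {t. c \<le> h t}" using assms(1) by (intro closed_Collect_le continuous_intros)
  moreover have "A = circle \<inter> {t. c \<le> h t}" by (auto simp: A_def)
  ultimately have A: "A \<in> sets lebesgue" "A \<subseteq> circle" by auto
  then have Al: "A \<in> lmeasurable" using mes_circle(3) fmeasurableI2 by blast
  have "c * mes A = (LINT t:circle|lebesgue. c * indicator A t)"
    by (rule integral_circle_indicator[OF Al A(2), symmetric])
  also have "\<dots> \<le> (LINT t:circle|lebesgue. h t)"
  proof (rule set_integral_mono)
    show "set_integrable lebesgue circle (\<lambda>t. c * indicator A t)"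
      using A assms(3) by (intro set_integrable_bounded[where B = c] borel_measurable_times borel_measurable_indicator)
        (auto simp: mes_circle indicator_def)
    show "set_integrable lebesgue circle h" by (rule set_integrable_continuous_circle[OF assms(1)])
  qed (use assms(2) in \<open>auto simp: A_def indicator_def\<close>)
  finally show "mes {t \<in> circle. c \<le> h t} \<le> (LINT t:circle|lebesgue. h t) / c"
    using assms(3) by (simp add: A_def field_simps)
  show "{t \<in> circle. c \<le> h t} \<in> sets lebesgue" using A by (simp add: A_def)
qed

text \<open>Passes uniform bounds for truncations at \<open>K\<close> or \<open>N\<close> on to the
  supremum, by continuity from below.\<close>

lemma mes_incseq_union_le:
  assumes "incseq A" "\<And>k::nat. A k \<in> sets lebesgue" "\<And>k. A k \<subseteq> circle" "\<And>k. mes (A k) \<le> B"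
  shows "mes (\<Union>k. A k) \<le> B"
proof -
  have "(\<Union>k. A k) \<in> lmeasurable"
    using assms(2,3) by (intro fmeasurableI2[OF mes_circle(3)]) auto
  then have "emeasure lebesgue (\<Union>k. A k) \<noteq> \<infinity>" by (auto simp: fmeasurable_def)
  then have "(\<lambda>k. mes (A k)) \<longlonglongrightarrow> mes (\<Union>k. A k)"
    using assms(1,2) by (intro Lim_measure_incseq) auto
  then show ?thesis using assms(4) by (intro LIMSEQ_le_const2) auto
qed

text \<open>The ball is where the bump is at least 1/2, so Markov's inequality doubles the constant
  12.\<close>

lemma mes_chord_ball_le:
  assumes "r > 0" "a \<in> circle"
  shows "{t \<in> circle. chord t a \<le> r} \<in> lmeasurable" "mes {t \<in> circle. chord t a \<le> r} \<le> 24 * pi * r"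
proof -
  have "chord t a \<le> r \<longleftrightarrow> 1 / 2 \<le> bump a r t" for t
  proof -
    have "chord t a \<le> r \<longleftrightarrow> (chord t a)\<^sup>2 \<le> r\<^sup>2" using assms(1) by (simp add: power2_le_iff_abs_le abs_le_iff)
    moreover have "(chord t a)\<^sup>2 + r\<^sup>2 > 0" using assms(1) by (simp add: add_nonneg_pos)
    ultimately show ?thesis by (simp add: bump_def field_simps)
  qed
  then have eq: "{t \<in> circle. chord t a \<le> r} = {t \<in> circle. 1 / 2 \<le> bump a r t}" by simp
  note m = markov_circle[OF continuous_bump[OF assms(1), of UNIV a] bump_nonneg, of "1/2"]
  show "{t \<in> circle. chord t a \<le> r} \<in> lmeasurable"
    unfolding eq using m(1) by (intro fmeasurableI2[OF mes_circle(3)]) auto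
  show "mes {t \<in> circle. chord t a \<le> r} \<le> 24 * pi * r"
    unfolding eq using m(2) integral_bump_le[OF assms] by simp
qed

section \<open>Dilated intervals and the Fejer mean of their union\<close>

text \<open>The shift is bounded crudely by \<open>\<beta> - 1\<close> lengths, twice the true
  range; one more length accounts for the position within \<open>I\<close>.\<close>

lemma dilate_subset:
  assumes "I \<in> dyadic" "\<beta> \<ge> 1"
  shows "dilate \<beta> I \<subseteq> {t \<in> circle. chord t (Inf I) \<le> real \<beta> * mes I}"
proof
  fix t assume "t \<in> dilate \<beta> I"
  then obtain i y k where *: "\<bar>i\<bar> \<le> (int \<beta> - 1) div 2" "t \<in> circle" "y \<in> I" "t = y + mes I * of_int i + 2 * pi * of_int k"
    unfolding dilate_def shift_interval_def by blast
  obtain n where n: "I \<in> dyadic_level n" using assms(1) dyadicE by blast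
  have m: "mes I > 0" by (simp add: dyadic_level_mes[OF n])
  have "\<bar>i\<bar> \<le> int \<beta> - 1" using *(1) assms(2) by linarith
  then have "\<bar>of_int i\<bar> \<le> real \<beta> - 1" by linarith
  then have "\<bar>mes I * of_int i\<bar> \<le> mes I * (real \<beta> - 1)"
    using m by (simp add: abs_mult)
  moreover have "\<bar>y - Inf I\<bar> \<le> mes I" using dyadic_level_dist[OF n *(3)] .
  moreover have "chord t (Inf I) \<le> \<bar>y + mes I * of_int i - Inf I\<bar>"
    unfolding *(4) chord_add_2pi by (rule chord_le)
  ultimately have "chord t (Inf I) \<le> real \<beta> * mes I" by (simp add: algebra_simps)
  then show "t \<in> {t \<in> circle. chord t (Inf I) \<le> real \<beta> * mes I}" using *(2) by simp
qed

lemma dilate_sets: 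
  assumes "I \<in> dyadic" shows "dilate \<beta> I \<in> sets lebesgue"
proof -
  obtain n k where I: "I = {- pi + 2 * pi * real k / 2 ^ n ..< - pi + 2 * pi * (real k + 1) / 2 ^ n}"
    using assms unfolding dyadic_def dyadic_level_def by blast
  then obtain a b where I: "I = {a..<b}" by blast
  define d where "d = mes I"
  have "shift_interval I i \<in> sets lebesgue" for i
  proof -
    \<comment> \<open>The reduction modulo 2 pi becomes a countable union of translates.\<close>
    have "shift_interval I i = circle \<inter> (\<Union>k::int. {a + (d * of_int i + 2 * pi * of_int k) ..< b + (d * of_int i + 2 * pi * of_int k)})"
    proof (intro set_eqI iffI)
      fix x assume "x \<in> circle \<inter> (\<Union>k::int. {a + (d * of_int i + 2 * pi * of_int k) ..< b + (d * of_int i + 2 * pi * of_int k)})"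
      then obtain k :: int where k: "x \<in> circle" "x \<in> {a + (d * of_int i + 2 * pi * of_int k) ..< b + (d * of_int i + 2 * pi * of_int k)}"
        by blast
      define y where "y = x - (d * of_int i + 2 * pi * of_int k)"
      have "y \<in> I" using k(2) unfolding I y_def by auto
      moreover have "x = y + d * of_int i + 2 * pi * of_int k" by (simp add: y_def)
      ultimately show "x \<in> shift_interval I i" using k(1) unfolding shift_interval_def d_def by blast
    next
      fix x assume "x \<in> shift_interval I i"
      then obtain y k where k: "x \<in> circle" "y \<in> I" "x = y + d * of_int i + 2 * pi * of_int k"
        unfolding shift_interval_def d_def by blast
      then have "x \<in> {a + (d * of_int i + 2 * pi * of_int k) ..< b + (d * of_int i + 2 * pi * of_int k)}"
        using k(2)[unfolded I] by simp
      then show "x \<in> circle \<inter> (\<Union>k::int. {a + (d * of_int i + 2 * pi * of_int k) ..< b + (d * of_int i + 2 * pi * of_int k)})"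
        using k(1) by blast
    qed
    also have "\<dots> \<in> sets lebesgue" by (intro sets.Int circle_sets sets.countable_UN) auto
    finally show ?thesis .
  qed
  then show ?thesis unfolding dilate_def by (intro sets.countable_UN'') auto
qed

lemma mes_dilate_le:
  assumes "I \<in> dyadic" "\<beta> \<ge> 1"
  shows "mes (dilate \<beta> I) \<le> 24 * pi * real \<beta> * mes I"
proof -
  obtain n where n: "I \<in> dyadic_level n" using assms(1) dyadicE by blast
  have r: "real \<beta> * mes I > 0" using assms(2) by (simp add: dyadic_level_mes[OF n])
  have a: "Inf I \<in> circle" using dyadic_level_Inf[OF n] dyadic_level_subset[OF n] by blast
  have "mes (dilate \<beta> I) \<le> mes {t \<in> circle. chord t (Inf I) \<le> real \<beta> * mes I}"
    by (intro measure_mono_fmeasurable dilate_subset dilate_sets assms mes_chord_ball_le(1) r a)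
  also have "\<dots> \<le> 24 * pi * (real \<beta> * mes I)" by (rule mes_chord_ball_le(2)[OF r a])
  finally show ?thesis by simp
qed

text \<open>A lower bound on the length bounds the dyadic level, so only finitely many intervals are
  involved.\<close>

lemma stopping_above_subset:
  assumes "\<epsilon> > 0" obtains K where "stopping_above f lam \<epsilon> \<subseteq> stopping_upto f lam K"
proof -
  obtain K :: nat where K: "2 * pi / \<epsilon> < 2 ^ K" using real_arch_pow[of 2] by auto
  have "stopping_above f lam \<epsilon> \<subseteq> stopping_upto f lam K"
  proof
    fix I assume I: "I \<in> stopping_above f lam \<epsilon>"
    then have s: "I \<in> stopping f lam" "mes I > \<epsilon>" by (auto simp: stopping_above_def)
    obtain n where n: "I \<in> dyadic_level n" using stopping_dyadic[OF s(1)] dyadicE by blast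
    have "\<epsilon> < 2 * pi / 2 ^ n" using s(2) by (simp add: dyadic_level_mes[OF n])
    then have "2 ^ n < 2 * pi / \<epsilon>" using assms by (simp add: field_simps)
    then have "(2::real) ^ n < 2 ^ K" using K by linarith
    then have "n \<le> K" by simp
    then show "I \<in> stopping_upto f lam K" using s(1) n by (auto simp: stopping_upto_def)
  qed
  then show ?thesis by (rule that)
qed

lemma dilated_union_sets: "dilated_union \<beta> f lam \<epsilon> \<in> sets lebesgue"
proof -
  have "stopping_above f lam \<epsilon> \<subseteq> dyadic" by (auto simp: stopping_above_def stopping_def)
  then show ?thesis
    unfolding dilated_union_def using countable_subset[OF _ countable_dyadic] dilate_sets
    by (intro sets.countable_UN'') auto
qed

text \<open>The separation \<open>2 * real \<beta> * mes I\<close> keeps the whole dilate at least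
  half as far from \<open>y\<close> as \<open>Inf I\<close> is. On it the kernel has inverse-square
  size, and multiplying by the measure of the dilate gives, up to \<open>1 / \<epsilon>\<close>, a
  multiple of the bump of \<open>I\<close>.\<close>

lemma fejer_mean_dilated_union_le:
  assumes "\<beta> \<ge> 1" "\<epsilon> > 0"
    and y: "\<And>I. I \<in> stopping f lam \<Longrightarrow> 2 * real \<beta> * mes I \<le> chord y (Inf I)"
      "\<And>K. (\<Sum>I\<in>stopping_upto f lam K. bump (Inf I) (mes I) y) \<le> \<eta>"
  shows "norm (fejer_mean m (indicator (dilated_union \<beta> f lam \<epsilon>)) y) \<le> 384 * real \<beta> * \<eta> / (real (m + 1) * \<epsilon>)"
proof -
  define D where "D = dilated_union \<beta> f lam \<epsilon>"
  define T where "T = stopping_above f lam \<epsilon>"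
  obtain K where K: "T \<subseteq> stopping_upto f lam K" unfolding T_def using stopping_above_subset[OF assms(2)] by blast
  then have fin: "finite T" using finite_stopping_upto finite_subset by blast
  have dy: "I \<in> dyadic" and st: "I \<in> stopping f lam" and big: "mes I > \<epsilon>" if "I \<in> T" for I
    using that by (auto simp: T_def stopping_above_def stopping_dyadic)
  have Ds: "D \<in> sets lebesgue" unfolding D_def by (rule dilated_union_sets)
  \<comment> \<open>The kernel bound 4 over the squared chord becomes 16 when the chord is only
    known to be at least half of \<open>chord y (Inf I)\<close>.\<close>
  define b where "b = (\<lambda>I. 16 / (real (m + 1) * (chord y (Inf I))\<^sup>2))"
  have bd: "norm (fejer_kernel m (y - t)) \<le> b I" if I: "I \<in> T" and t: "t \<in> dilate \<beta> I" for I t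
  proof -
    have c: "2 * real \<beta> * mes I \<le> chord y (Inf I)" using y(1)[OF st[OF I]] .
    have pos: "real \<beta> * mes I > 0" using assms(1,2) big[OF I] by simp
    have "chord t (Inf I) \<le> real \<beta> * mes I" using dilate_subset[OF dy[OF I] assms(1)] t by blast
    then have le: "chord y (Inf I) / 2 \<le> chord y t" using chord_triangle[of y "Inf I" t] c by linarith
    then have "chord y t > 0" using c pos by linarith
    then have "norm (fejer_kernel m (y - t)) \<le> 4 / (real (m + 1) * (chord y t)\<^sup>2)" by (rule fejer_kernel_le)
    also have "\<dots> \<le> 4 / (real (m + 1) * (chord y (Inf I) / 2)\<^sup>2)"
    proof (rule divide_left_mono)
      show "real (m + 1) * (chord y (Inf I) / 2)\<^sup>2 \<le> real (m + 1) * (chord y t)\<^sup>2"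
        using le c pos by (intro mult_left_mono power_mono) auto
      show "0 < real (m + 1) * (chord y t)\<^sup>2 * (real (m + 1) * (chord y (Inf I) / 2)\<^sup>2)"
        using \<open>chord y t > 0\<close> c pos by (intro mult_pos_pos zero_less_power) auto
    qed auto
    finally show ?thesis by (simp add: b_def power_divide)
  qed
  have b0: "b I \<ge> 0" for I by (simp add: b_def)
  have iI: "set_integrable lebesgue circle (\<lambda>t. b I * indicator (dilate \<beta> I) t)" if "I \<in> T" for I
    using dilate_sets[OF dy[OF that]] b0[of I]
    by (intro set_integrable_bounded[where B = "b I"] borel_measurable_times borel_measurable_indicator)
       (auto simp: mes_circle indicator_def)
  have "norm (LINT t:circle|lebesgue. fejer_kernel m (y - t) * indicator D t)
      \<le> (LINT t:circle|lebesgue. norm (fejer_kernel m (y - t) * indicator D t))"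
    "(LINT t:circle|lebesgue. norm (fejer_kernel m (y - t) * indicator D t))
      \<le> (LINT t:circle|lebesgue. \<Sum>I\<in>T. b I * indicator (dilate \<beta> I) t)"
  proof -
    have c: "continuous_on UNIV (\<lambda>t. fejer_kernel m (y - t))"
      unfolding fejer_kernel_def by (intro continuous_intros) (simp only: of_nat_eq_0_iff, simp)
    have i: "set_integrable lebesgue circle (\<lambda>t. fejer_kernel m (y - t) * indicator D t)"
    proof (rule set_integrable_bounded)
      show "(\<lambda>t. fejer_kernel m (y - t) * indicator D t) \<in> borel_measurable lebesgue"
        using Ds by (intro borel_measurable_times continuous_imp_borel_measurable_lebesgue[OF c] borel_measurable_indicator)
      show "norm (fejer_kernel m (y - t) * indicator D t) \<le> (\<Sum>I\<in>T. b I)" for t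
      proof (cases "t \<in> D")
        case True
        then obtain I where "I \<in> T" "t \<in> dilate \<beta> I" by (auto simp: D_def dilated_union_def T_def)
        then have "norm (fejer_kernel m (y - t)) \<le> b I" "b I \<le> (\<Sum>I\<in>T. b I)"
          using bd fin b0 by (auto intro: member_le_sum)
        then show ?thesis using True by simp
      qed (simp add: b0 sum_nonneg)
    qed (simp add: mes_circle)
    show "norm (LINT t:circle|lebesgue. fejer_kernel m (y - t) * indicator D t)
      \<le> (LINT t:circle|lebesgue. norm (fejer_kernel m (y - t) * indicator D t))"
      by (rule set_integral_norm_bound[OF i])
    show "(LINT t:circle|lebesgue. norm (fejer_kernel m (y - t) * indicator D t))
      \<le> (LINT t:circle|lebesgue. \<Sum>I\<in>T. b I * indicator (dilate \<beta> I) t)"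
    proof (intro set_integral_mono set_integrable_norm i set_integral_sum(2) iI)
      fix t
      show "norm (fejer_kernel m (y - t) * indicator D t) \<le> (\<Sum>I\<in>T. b I * indicator (dilate \<beta> I) t)"
      proof (cases "t \<in> D")
        case True
        then obtain I where I: "I \<in> T" "t \<in> dilate \<beta> I" by (auto simp: D_def dilated_union_def T_def)
        have "norm (fejer_kernel m (y - t)) \<le> b I * indicator (dilate \<beta> I) t" using bd[OF I] I by simp
        also have "\<dots> \<le> (\<Sum>I\<in>T. b I * indicator (dilate \<beta> I) t)"
          using I(1) fin b0 by (intro member_le_sum[where f = "\<lambda>I. b I * indicator (dilate \<beta> I) t"]) auto
        finally show ?thesis using True by simp
      qed (simp add: b0 sum_nonneg)
    qed
  qed
  then have "norm (LINT t:circle|lebesgue. fejer_kernel m (y - t) * indicator D t)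
      \<le> (LINT t:circle|lebesgue. \<Sum>I\<in>T. b I * indicator (dilate \<beta> I) t)" by linarith
  also have "\<dots> = (\<Sum>I\<in>T. LINT t:circle|lebesgue. b I * indicator (dilate \<beta> I) t)"
    by (rule set_integral_sum(1)[OF iI])
  also have "\<dots> = (\<Sum>I\<in>T. b I * mes (dilate \<beta> I))"
  proof (intro sum.cong refl)
    fix I assume I: "I \<in> T"
    have sub: "dilate \<beta> I \<subseteq> circle" using dilate_subset[OF dy[OF I] assms(1)] by blast
    then have "dilate \<beta> I \<in> lmeasurable" using dilate_sets[OF dy[OF I]] fmeasurableI2[OF mes_circle(3)] by blast
    then show "(LINT t:circle|lebesgue. b I * indicator (dilate \<beta> I) t) = b I * mes (dilate \<beta> I)"
      by (rule integral_circle_indicator[OF _ sub])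
  qed
  also have "\<dots> \<le> (\<Sum>I\<in>T. 768 * pi * real \<beta> / (real (m + 1) * \<epsilon>) * bump (Inf I) (mes I) y)"
  proof (rule sum_mono)
    fix I assume I: "I \<in> T"
    define c where "c = chord y (Inf I)"
    have c: "2 * real \<beta> * mes I \<le> c" using y(1)[OF st[OF I]] by (simp add: c_def)
    have m: "mes I > 0" using big[OF I] assms(2) by linarith
    have "1 * mes I \<le> 2 * real \<beta> * mes I" using assms(1) m by (intro mult_right_mono) auto
    then have mc: "mes I \<le> c" "c > 0" using c m by linarith+
    have "b I * mes (dilate \<beta> I) \<le> b I * (24 * pi * real \<beta> * mes I)"
      using b0 by (intro mult_left_mono mes_dilate_le dy[OF I] assms(1)) auto
    also have "\<dots> = 384 * pi * real \<beta> / real (m + 1) * (mes I / c\<^sup>2)"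
      by (simp add: b_def c_def)
    also have "\<dots> \<le> 384 * pi * real \<beta> / real (m + 1) * (2 * bump (Inf I) (mes I) y / \<epsilon>)"
    proof (rule mult_left_mono)
      \<comment> \<open>The lower bound on the length enters here: it buys the second factor
        \<open>mes I\<close> of the bump for \<open>1 / \<epsilon>\<close>.\<close>
      have "mes I / c\<^sup>2 \<le> (mes I)\<^sup>2 / c\<^sup>2 / \<epsilon>"
        using big[OF I] m mc(2) assms(2) by (simp add: field_simps power2_eq_square)
      also have "(mes I)\<^sup>2 / c\<^sup>2 \<le> 2 * bump (Inf I) (mes I) y"
        unfolding c_def using mc m by (intro sq_ratio_le_bump) (auto simp: c_def)
      finally show "mes I / c\<^sup>2 \<le> 2 * bump (Inf I) (mes I) y / \<epsilon>"
        using assms(2) by (simp add: divide_right_mono)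
    qed auto
    finally show "b I * mes (dilate \<beta> I) \<le> 768 * pi * real \<beta> / (real (m + 1) * \<epsilon>) * bump (Inf I) (mes I) y"
      by (simp add: mult_ac)
  qed
  also have "\<dots> = 768 * pi * real \<beta> / (real (m + 1) * \<epsilon>) * (\<Sum>I\<in>T. bump (Inf I) (mes I) y)"
    by (simp add: sum_distrib_left)
  also have "\<dots> \<le> 768 * pi * real \<beta> / (real (m + 1) * \<epsilon>) * \<eta>"
  proof (rule mult_left_mono)
    have "(\<Sum>I\<in>T. bump (Inf I) (mes I) y) \<le> (\<Sum>I\<in>stopping_upto f lam K. bump (Inf I) (mes I) y)"
      by (intro sum_mono2 finite_stopping_upto K) auto
    then show "(\<Sum>I\<in>T. bump (Inf I) (mes I) y) \<le> \<eta>" using y(2)[of K] by linarith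
  qed (use assms(2) in auto)
  finally have *: "norm (LINT t:circle|lebesgue. fejer_kernel m (y - t) * indicator D t) \<le> 768 * pi * real \<beta> / (real (m + 1) * \<epsilon>) * \<eta>" .
  have "norm (fejer_mean m (indicator D) y) = norm (LINT t:circle|lebesgue. fejer_kernel m (y - t) * indicator D t) / (2 * pi)"
    unfolding fejer_mean_kernel[OF indicator_L1[OF Ds]] by (simp add: norm_divide norm_mult)
  also have "\<dots> \<le> 768 * pi * real \<beta> / (real (m + 1) * \<epsilon>) * \<eta> / (2 * pi)" using * by (intro divide_right_mono) auto
  also have "\<dots> = 384 * real \<beta> * \<eta> / (real (m + 1) * \<epsilon>)"
  proof -
    have "768 * pi * b / q * \<eta> / (2 * pi) = 384 * b * \<eta> / q" for b q :: real by simp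
    then show ?thesis .
  qed
  finally show ?thesis by (simp add: D_def)
qed

text \<open>From \<open>2 * \<delta> < 1\<close> the block length is at most sqrt N, so the block
  number plus 1 is at least i / sqrt N. With squared logarithm at least 1/4 and
  \<open>n i div 10 + 1\<close> at least n_i / 10, the product in the denominator is at least (1/10)
  * 20 * (1/4) = 1/2 of that number.\<close>

lemma beta'_bound:
  assumes "0 < \<delta>" "\<delta> < 1 / 2" "1 \<le> i" "i \<le> N" "n i > 0"
  shows "beta' \<delta> n N i > 0" "1 / (real (n i div 10 + 1) * beta' \<delta> n N i) \<le> 2 * sqrt (real N) / real i"
proof -
  define K0 where "K0 = block_length \<delta> N"
  \<comment> \<open>This \<open>j\<close> is the block number plus 1, the quantity that occurs in
    \<open>beta'\<close>; it is at least 2.\<close>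
  define j where "j = real (block_index \<delta> N i) + 1"
  have K1: "K0 \<ge> 1" unfolding K0_def using assms by (intro block_length_pos) auto
  have K2: "real K0 \<le> sqrt (real N)"
  proof -
    define k where "k = real (nat \<lfloor>sqrt (real N)\<rfloor>)"
    have "\<lfloor>sqrt (real N)\<rfloor> \<ge> 1" using assms by simp
    then have k: "k \<ge> 1" "k \<le> sqrt (real N)" unfolding k_def by linarith+
    have "k powr (2 * \<delta>) \<le> k powr 1" using k(1) assms(2) by (intro powr_mono) auto
    then have "k powr (2 * \<delta>) \<le> k" using k(1) by simp
    moreover have "real K0 \<le> k powr (2 * \<delta>)" unfolding K0_def block_length_def k_def by simp
    ultimately show ?thesis using k(2) by linarith
  qed
  have "real i / real K0 \<le> real (i div K0) + 1"
  proof -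
    have "i < (i div K0 + 1) * K0" using K1 by (simp add: dividend_less_div_times add.commute)
    then have "real i < (real (i div K0) + 1) * real K0" by (metis of_nat_less_iff of_nat_mult of_nat_add of_nat_1)
    then show ?thesis using K1 by (simp add: field_simps)
  qed
  then have j: "real i / real K0 \<le> j" "2 \<le> j" by (simp_all add: j_def block_index_def K0_def)
  have "real i / sqrt (real N) \<le> real i / real K0" using K1 K2 assms by (intro divide_left_mono) auto
  then have j3: "real i / sqrt (real N) \<le> j" using j(1) by linarith
  have "1 / 2 \<le> ln (2::real)" using ln2_ge_two_thirds by simp
  also have "\<dots> \<le> ln j" using j(2) by simp
  finally have "(1 / 2)\<^sup>2 \<le> (ln j)\<^sup>2" by (intro power_mono) auto
  then have l: "1 / 4 \<le> (ln j)\<^sup>2" by (simp add: power2_eq_square)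
  have b: "beta' \<delta> n N i = 20 * j * (ln j)\<^sup>2 / real (n i)" by (simp add: beta'_def Let_def j_def)
  have "20 * j * (1 / 4) \<le> 20 * j * (ln j)\<^sup>2" using l j(2) by (intro mult_left_mono) auto
  then have b5: "5 * j / real (n i) \<le> beta' \<delta> n N i" unfolding b by (intro divide_right_mono) auto
  moreover have "0 < 5 * j / real (n i)" using j(2) assms(5) by simp
  ultimately show b0: "beta' \<delta> n N i > 0" by linarith
  have "real (n i) / 10 * (5 * j / real (n i)) \<le> real (n i div 10 + 1) * beta' \<delta> n N i"
  proof (intro mult_mono b5)
    have "x \<le> 10 * (x div 10 + 1)" for x :: nat by presburger
    from this[of "n i"] have "n i \<le> 10 * (n i div 10 + 1)" .
    then have "real (n i) \<le> real (10 * (n i div 10 + 1))" by (simp only: of_nat_le_iff)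
    then show "real (n i) / 10 \<le> real (n i div 10 + 1)" by simp
  qed (use j(2) in auto)
  then have "j / 2 \<le> real (n i div 10 + 1) * beta' \<delta> n N i" using assms(5) by simp
  moreover have "real i / sqrt (real N) / 2 \<le> j / 2" using j3 by simp
  ultimately have "real i / sqrt (real N) / 2 \<le> real (n i div 10 + 1) * beta' \<delta> n N i" by (rule order_trans[rotated])
  moreover have "0 < real i / sqrt (real N) / 2" using assms by simp
  ultimately have "1 / (real (n i div 10 + 1) * beta' \<delta> n N i) \<le> 1 / (real i / sqrt (real N) / 2)"
    using b0 by (intro divide_left_mono mult_pos_pos) auto
  then show "1 / (real (n i div 10 + 1) * beta' \<delta> n N i) \<le> 2 * sqrt (real N) / real i" by (simp add: mult.commute)
qed

section \<open>Measure of the exceptional sets\<close>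

text \<open>The Marcinkiewicz function truncated at level \<open>K\<close>: finite sums are
  continuous, and the full function is recovered as a supremum over \<open>K\<close>.\<close>

definition overlap :: "(real \<Rightarrow> complex) \<Rightarrow> real \<Rightarrow> nat \<Rightarrow> real \<Rightarrow> real" where
  "overlap f lam K y = (\<Sum>I\<in>stopping_upto f lam K. bump (Inf I) (mes I) y)"

lemma stopping_upto_dyadic:
  assumes "I \<in> stopping_upto f lam K"
  shows "mes I > 0" "Inf I \<in> circle"
proof -
  obtain n where n: "I \<in> dyadic_level n" using assms by (auto simp: stopping_upto_def)
  show "mes I > 0" by (simp add: dyadic_level_mes[OF n])
  show "Inf I \<in> circle" using dyadic_level_Inf[OF n] dyadic_level_subset[OF n] by blast
qed

lemma continuous_overlap: "continuous_on S (overlap f lam K)"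
  unfolding overlap_def[abs_def]
  by (intro continuous_intros continuous_bump stopping_upto_dyadic)

lemma overlap_mono: "K \<le> L \<Longrightarrow> overlap f lam K y \<le> overlap f lam L y"
  unfolding overlap_def by (intro sum_mono2 finite_stopping_upto stopping_upto_mono) auto

lemma integral_overlap_le:
  assumes "f \<in> L1" "lam > norm1 f / (2 * pi)"
  shows "(LINT y:circle|lebesgue. overlap f lam K y) \<le> 12 * pi * (norm1 f / lam)"
proof -
  have "(LINT y:circle|lebesgue. overlap f lam K y)
      = (\<Sum>I\<in>stopping_upto f lam K. LINT y:circle|lebesgue. bump (Inf I) (mes I) y)"
    unfolding overlap_def
    by (intro set_integral_sum(1) set_integrable_continuous_circle continuous_bump stopping_upto_dyadic)
  also have "\<dots> \<le> (\<Sum>I\<in>stopping_upto f lam K. 12 * pi * mes I)"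
    by (intro sum_mono integral_bump_le stopping_upto_dyadic)
  also have "\<dots> = 12 * pi * (\<Sum>I\<in>stopping_upto f lam K. mes I)" by (simp add: sum_distrib_left)
  also have "\<dots> \<le> 12 * pi * (norm1 f / lam)"
    by (intro mult_left_mono sum_mes_stopping_upto assms) auto
  finally show ?thesis .
qed

lemma mes_overlap_le:
  assumes "f \<in> L1" "lam > norm1 f / (2 * pi)" "\<eta> > 0"
  shows "(\<Union>K. {y \<in> circle. \<eta> \<le> overlap f lam K y}) \<in> sets lebesgue"
    and "mes (\<Union>K. {y \<in> circle. \<eta> \<le> overlap f lam K y}) \<le> 12 * pi / \<eta> * (norm1 f / lam)"
proof -
  have nn: "0 \<le> overlap f lam K y" for K y unfolding overlap_def by (intro sum_nonneg) simp
  note m = markov_circle[OF continuous_overlap[of UNIV f lam] nn assms(3)]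
  show "(\<Union>K. {y \<in> circle. \<eta> \<le> overlap f lam K y}) \<in> sets lebesgue" using m(1) by auto
  show "mes (\<Union>K. {y \<in> circle. \<eta> \<le> overlap f lam K y}) \<le> 12 * pi / \<eta> * (norm1 f / lam)"
  proof (rule mes_incseq_union_le)
    show "incseq (\<lambda>K. {y \<in> circle. \<eta> \<le> overlap f lam K y})"
      using overlap_mono order_trans by (fastforce simp: incseq_def)
    fix K
    have "mes {y \<in> circle. \<eta> \<le> overlap f lam K y} \<le> (LINT y:circle|lebesgue. overlap f lam K y) / \<eta>" by (rule m(2))
    also have "\<dots> \<le> 12 * pi * (norm1 f / lam) / \<eta>"
      using assms(3) by (intro divide_right_mono integral_overlap_le assms) auto
    finally show "mes {y \<in> circle. \<eta> \<le> overlap f lam K y} \<le> 12 * pi / \<eta> * (norm1 f / lam)" by (simp add: mult.commute)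
  qed (use m(1) in auto)
qed

text \<open>The weights do not depend on \<open>N\<close>, so the sets increase with
  \<open>N\<close> and the supremum costs only the total weight \<open>Z\<close>.\<close>

lemma mes_weighted_sum_le:
  fixes G :: "nat \<Rightarrow> real \<Rightarrow> real"
  assumes "\<And>i. continuous_on UNIV (G i)" "\<And>i y. 0 \<le> G i y" "\<And>i. 0 \<le> w i"
    and "\<And>i. i \<ge> 1 \<Longrightarrow> (LINT y:circle|lebesgue. G i y) \<le> B" "\<And>N::nat. (\<Sum>i=1..N. w i) \<le> Z" "c > 0" "B \<ge> 0"
  shows "(\<Union>N. {y \<in> circle. c \<le> (\<Sum>i=1..N. w i * G i y)}) \<in> sets lebesgue"
    and "mes (\<Union>N. {y \<in> circle. c \<le> (\<Sum>i=1..N. w i * G i y)}) \<le> Z * B / c"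
proof -
  have nn: "0 \<le> (\<Sum>i=1..N. w i * G i y)" for N y using assms(2,3) by (intro sum_nonneg mult_nonneg_nonneg)
  have cont: "continuous_on UNIV (\<lambda>y. \<Sum>i=1..N. w i * G i y)" for N
    by (intro continuous_intros assms(1))
  note m = markov_circle[OF cont nn assms(6)]
  show "(\<Union>N. {y \<in> circle. c \<le> (\<Sum>i=1..N. w i * G i y)}) \<in> sets lebesgue" using m(1) by auto
  show "mes (\<Union>N. {y \<in> circle. c \<le> (\<Sum>i=1..N. w i * G i y)}) \<le> Z * B / c"
  proof (rule mes_incseq_union_le)
    have "(\<Sum>i=1..M. w i * G i y) \<le> (\<Sum>i=1..N. w i * G i y)" if "M \<le> N" for M N y
      using that assms(2,3) by (intro sum_mono2) auto
    then show "incseq (\<lambda>N. {y \<in> circle. c \<le> (\<Sum>i=1..N. w i * G i y)})"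
      using order_trans by (fastforce simp: incseq_def)
    fix N
    have "(LINT y:circle|lebesgue. (\<Sum>i=1..N. w i * G i y)) = (\<Sum>i=1..N. LINT y:circle|lebesgue. w i * G i y)"
      by (intro set_integral_sum(1) set_integrable_continuous_circle continuous_intros assms(1))
    also have "\<dots> \<le> (\<Sum>i=1..N. w i * B)"
      using assms(3,4) by (intro sum_mono) (auto intro: mult_left_mono)
    also have "\<dots> \<le> Z * B"
      unfolding sum_distrib_right[symmetric] by (intro mult_right_mono assms(5,7))
    finally have "(LINT y:circle|lebesgue. (\<Sum>i=1..N. w i * G i y)) / c \<le> Z * B / c"
      using assms(6) by (intro divide_right_mono) auto
    then show "mes {y \<in> circle. c \<le> (\<Sum>i=1..N. w i * G i y)} \<le> Z * B / c" using m(2)[of N] by linarith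
  qed (use m(1) in auto)
qed

text \<open>Meant for \<open>u\<close> equal to \<open>f\<close> or its conjugate: only moduli enter
  the stopping intervals, so the exceptional set of \<open>f\<close> serves both functions and all
  degrees.\<close>

lemma modulated_majorant:
  assumes "f \<in> L1" "lam > norm1 f / (2 * pi)" "n \<ge> 1" "\<And>t. norm (u t) = norm (f t)" "u \<in> L1"
  shows "\<exists>g::real \<Rightarrow> complex. continuous_on UNIV g \<and> (LINT t:circle|lebesgue. (norm (g t))\<^sup>2) \<le> 2 * lam * norm1 f \<and>
    (\<forall>y\<in>circle. (\<forall>I\<in>stopping f lam. 2 * mes I \<le> chord y (Inf I)) \<and> (\<forall>K. overlap f lam K y \<le> 1)
      \<longrightarrow> norm (upper_mean n u y) \<le> 129 * lam + norm (g y))"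
proof -
  define v where "v = (\<lambda>t. cis (- real n * t) * u t)"
  have nv: "norm (v t) = norm (f t)" for t by (simp add: v_def norm_mult assms(4))
  have "v \<in> L1" unfolding v_def L1_def mem_Collect_eq by (rule set_integrable_cis_mult[OF assms(5)])
  moreover have "norm1 v = norm1 f" by (simp add: norm1_def nv)
  moreover have "stopping v lam = stopping f lam" using nv by (rule stopping_cong)
  moreover from this have "stopping_upto v lam K = stopping_upto f lam K" for K by (simp add: stopping_upto_def)
  ultimately show ?thesis
    using cz_one_sided_mean[of v lam n] assms(2,3)
    unfolding norm_upper_mean v_def[symmetric] overlap_def by simp
qed

text \<open>The threshold is the value of the bump at chord \<open>b * r\<close>, and the bump
  decreases with the chord. Smallness of the overlap thereby yields separation from every stopping
  interval.\<close>

lemma chord_ge_of_bump_le: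
  assumes "bump a r y \<le> 1 / (1 + b\<^sup>2)" "r > 0"
  shows "b * r \<le> chord y a"
proof -
  have "r\<^sup>2 * (1 + b\<^sup>2) \<le> (chord y a)\<^sup>2 + r\<^sup>2"
  proof -
    have "(chord y a)\<^sup>2 + r\<^sup>2 > 0" "1 + b\<^sup>2 > 0" using assms(2) by (simp_all add: add_nonneg_pos add_pos_nonneg)
    then show ?thesis using assms(1) by (simp add: bump_def divide_simps)
  qed
  then have "(b * r)\<^sup>2 \<le> (chord y a)\<^sup>2" by (simp add: power_mult_distrib algebra_simps)
  then show ?thesis by (rule power2_le_imp_le) simp
qed

section \<open>The pointwise estimate and the conclusion\<close>

lemma T_loc_minus_T_op:
  "T_loc \<beta> \<delta> lam n N f y - T_op n N f y =
    - (\<Sum>i=1..N. (fourier_sum (n i) f y - vp_mean (n i) f y) *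
        fejer_mean (n i div 10) (indicator (dilated_union \<beta> f lam (beta' \<delta> n N i))) y) / of_nat N"
  unfolding T_loc_def T_op_def fejer_mean_indicator_compl[OF dilated_union_sets]
  by (simp add: right_diff_distrib sum_subtractf diff_divide_distrib)

text \<open>The left side is 1 / (i sqrt N); replacing N by the smaller i gives a summable weight
  free of N.\<close>

lemma weight_le:
  assumes "1 \<le> i" "i \<le> N"
  shows "sqrt (real N) / real i / real N \<le> real i powr (- 3 / 2)"
proof -
  have "sqrt (real N) / real i / real N = 1 / (real i * sqrt (real N))"
    using assms by (simp add: field_simps)
  also have "\<dots> \<le> 1 / (real i * sqrt (real i))"
    using assms by (intro divide_left_mono mult_left_mono) auto
  also have "\<dots> = real i powr (- 3 / 2)"
  proof -
    have "real i powr (- 3 / 2) = 1 / real i powr (1 + 1 / 2)" by (simp add: powr_minus_divide)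
    then show ?thesis using assms by (simp only: powr_add powr_half_sqrt) simp
  qed
  finally show ?thesis .
qed

text \<open>Pairs the bound of the Fejer mean with \<open>A + G i\<close>. The constant
  \<open>A\<close> is charged to the total weight, the part \<open>G i\<close> to a weighted sum;
  768 is 384 times the 2 of \<open>beta'_bound\<close>.\<close>

lemma norm_T_loc_minus_T_op_le:
  assumes \<beta>: "\<beta> \<ge> 1" and lam: "lam > 0" and \<delta>: "0 < \<delta>" "\<delta> < 1 / 2" and n: "\<And>i. i \<ge> 1 \<Longrightarrow> n i > 0"
    and y: "\<And>I. I \<in> stopping f lam \<Longrightarrow> 2 * real \<beta> * mes I \<le> chord y (Inf I)"
      "\<And>K. overlap f lam K y \<le> \<eta>"
    and G: "\<And>i. i \<ge> 1 \<Longrightarrow> norm (fourier_sum (n i) f y - vp_mean (n i) f y) \<le> A + G i"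
    and w: "(\<Sum>i=1..N. real i powr (- 3 / 2)) \<le> Z" "(\<Sum>i=1..N. real i powr (- 3 / 2) * G i) \<le> B"
    and A: "A \<ge> 0" and N: "N \<ge> 1"
  shows "norm (T_loc \<beta> \<delta> lam n N f y - T_op n N f y) \<le> 768 * real \<beta> * \<eta> * (A * Z + B)"
proof -
  define h where "h = (\<lambda>i. fourier_sum (n i) f y - vp_mean (n i) f y)"
  define s where "s = (\<lambda>i. fejer_mean (n i div 10) (indicator (dilated_union \<beta> f lam (beta' \<delta> n N i))) y)"
  have \<eta>: "\<eta> \<ge> 0" using y(2)[of 0] sum_nonneg[of "stopping_upto f lam 0" "\<lambda>I. bump (Inf I) (mes I) y"]
    unfolding overlap_def by (meson bump_nonneg order_trans)
  have s: "norm (s i) \<le> 768 * real \<beta> * \<eta> * (sqrt (real N) / real i)" if i: "i \<in> {1..N}" for i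
  proof -
    have b: "beta' \<delta> n N i > 0" "1 / (real (n i div 10 + 1) * beta' \<delta> n N i) \<le> 2 * sqrt (real N) / real i"
      using beta'_bound[of \<delta> i N n] \<delta> i n[of i] by auto
    have "norm (s i) \<le> 384 * real \<beta> * \<eta> / (real (n i div 10 + 1) * beta' \<delta> n N i)"
      unfolding s_def by (rule fejer_mean_dilated_union_le[OF \<beta> b(1) y(1) y(2)[unfolded overlap_def]])
    also have "\<dots> = 384 * real \<beta> * \<eta> * (1 / (real (n i div 10 + 1) * beta' \<delta> n N i))" by simp
    also have "\<dots> \<le> 384 * real \<beta> * \<eta> * (2 * sqrt (real N) / real i)"
      using b(2) \<eta> by (intro mult_left_mono) auto
    finally show ?thesis by simp
  qed
  have "norm (T_loc \<beta> \<delta> lam n N f y - T_op n N f y) = norm (\<Sum>i=1..N. h i * s i) / real N"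
    unfolding T_loc_minus_T_op h_def s_def by (simp add: norm_divide)
  also have "\<dots> \<le> (\<Sum>i=1..N. norm (h i) * norm (s i)) / real N"
    by (intro divide_right_mono order_trans[OF norm_sum]) (auto simp: norm_mult)
  also have "\<dots> = (\<Sum>i=1..N. norm (h i) * norm (s i) / real N)" by (rule sum_divide_distrib)
  also have "\<dots> \<le> (\<Sum>i=1..N. 768 * real \<beta> * \<eta> * (A * real i powr (- 3 / 2) + real i powr (- 3 / 2) * G i))"
  proof (rule sum_mono)
    fix i assume i: "i \<in> {1..N}"
    have g: "norm (h i) \<le> A + G i" using G[of i] i by (simp add: h_def)
    have "norm (h i) * norm (s i) / real N \<le> norm (h i) * (768 * real \<beta> * \<eta> * (sqrt (real N) / real i)) / real N"
      using s[OF i] by (intro divide_right_mono mult_left_mono) auto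
    also have "\<dots> = 768 * real \<beta> * \<eta> * norm (h i) * (sqrt (real N) / real i / real N)" by simp
    also have "\<dots> \<le> 768 * real \<beta> * \<eta> * norm (h i) * real i powr (- 3 / 2)"
      using i \<eta> by (intro mult_left_mono weight_le) auto
    also have "\<dots> \<le> 768 * real \<beta> * \<eta> * (A + G i) * real i powr (- 3 / 2)"
      using g \<eta> by (intro mult_right_mono mult_left_mono) auto
    finally show "norm (h i) * norm (s i) / real N
      \<le> 768 * real \<beta> * \<eta> * (A * real i powr (- 3 / 2) + real i powr (- 3 / 2) * G i)" by (simp add: algebra_simps)
  qed
  also have "\<dots> = 768 * real \<beta> * \<eta> * (A * (\<Sum>i=1..N. real i powr (- 3 / 2)) + (\<Sum>i=1..N. real i powr (- 3 / 2) * G i))"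
    by (simp only: sum_distrib_left sum.distrib distrib_left)
  also have "\<dots> \<le> 768 * real \<beta> * \<eta> * (A * Z + B)"
    using w A \<eta> by (intro mult_left_mono add_mono) auto
  finally show ?thesis .
qed

theorem lemma6p2:
  fixes \<beta> :: nat
  assumes "odd \<beta>" and "\<beta> > 7"
  shows "\<exists>C::real. \<forall>(\<delta>::real) (f::real \<Rightarrow> complex) (lam::real) (n::nat \<Rightarrow> nat).
    0 < \<delta> \<and> \<delta> < 1 / 2 \<and> f \<in> L1 \<and> lam > norm1 f / (2 * pi) \<and>
    strict_mono_on {1..} n \<and> (\<forall>j\<ge>1. n j > 0) \<longrightarrow>
    mes {y \<in> circle. (SUP N\<in>{1..}. ereal (norm (T_loc \<beta> \<delta> lam n N f y - T_op n N f y)))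
                         > ereal (lam / 2)}
      \<le> C * (1 / (1 - 2 * \<delta>)) * sqrt (norm1 f / lam)"
proof -
  have \<beta>: "\<beta> \<ge> 1" using assms(2) by simp
  \<comment> \<open>The term at index 0 vanishes, because \<open>0 powr x\<close> is 0.\<close>
  define Z where "Z = (\<Sum>i. real i powr (- 3 / 2))"
  have Zs: "summable (\<lambda>i. real i powr (- 3 / 2))" by (simp add: summable_real_powr_iff)
  then have Z: "(\<Sum>i=1..N. real i powr (- 3 / 2)) \<le> Z" for N
    unfolding Z_def by (intro sum_le_suminf) auto
  have Z0: "Z \<ge> 0" using Z[of 0] by simp
  \<comment> \<open>The first two summands of the denominator secure the separation
    \<open>2 * real \<beta> * mes I\<close>; the last makes the final pointwise bound at most
    \<open>lam / 2\<close>.\<close>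
  define \<eta> where "\<eta> = 1 / (1 + (2 * real \<beta>)\<^sup>2 + 1536 * real \<beta> * (260 * Z + 1))"
  have den: "1 + (2 * real \<beta>)\<^sup>2 > 0" "1536 * real \<beta> * (260 * Z + 1) > 0" 
    using \<beta> Z0 by (auto intro!: add_pos_nonneg mult_pos_pos)
  have \<eta>: "\<eta> > 0" "\<eta> \<le> 1 / (1 + (2 * real \<beta>)\<^sup>2)" "\<eta> \<le> 1 / (1536 * real \<beta> * (260 * Z + 1))"
  proof -
    have "1 / (p + q) > 0" "1 / (p + q) \<le> 1 / p" "1 / (p + q) \<le> 1 / q" if "p > 0" "q > 0" for p q :: real
      using that by (auto intro!: divide_left_mono mult_pos_pos)
    then show "\<eta> > 0" "\<eta> \<le> 1 / (1 + (2 * real \<beta>)\<^sup>2)" "\<eta> \<le> 1 / (1536 * real \<beta> * (260 * Z + 1))"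
      unfolding \<eta>_def using den by blast+
  qed
  have "1 / (1 + (2 * real \<beta>)\<^sup>2) \<le> 1" using den(1) by (simp add: divide_le_eq_1_pos)
  then have \<eta>1: "\<eta> \<le> 1" using \<eta>(2) by linarith
  \<comment> \<open>The summands are the contributions of the sets \<open>E1\<close> and
    \<open>E2\<close> below.\<close>
  define C where "C = 12 * pi / \<eta> + 4 * Z"
  have C: "C \<ge> 0" unfolding C_def using \<eta>(1) Z0 by auto
  show ?thesis
  proof (intro exI[of _ "C * sqrt (2 * pi)"] allI impI)
    fix \<delta> :: real and f :: "real \<Rightarrow> complex" and lam :: real and n :: "nat \<Rightarrow> nat"
    assume H: "0 < \<delta> \<and> \<delta> < 1 / 2 \<and> f \<in> L1 \<and> lam > norm1 f / (2 * pi) \<and>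
      strict_mono_on {1..} n \<and> (\<forall>j\<ge>1. n j > 0)"
    then have f: "f \<in> L1" and lam: "lam > norm1 f / (2 * pi)" and n: "\<And>j. j \<ge> 1 \<Longrightarrow> n j > 0"
      and \<delta>: "0 < \<delta>" "\<delta> < 1 / 2" by auto
    note lam0 = lam_pos[OF f lam]
    have cnjf: "(\<lambda>t. cnj (f t)) \<in> L1"
      using f integrable_cnj[of lebesgue "\<lambda>t. indicator circle t *\<^sub>R f t"]
      unfolding L1_def set_integrable_def by simp
    define good where "good = (\<lambda>y. (\<forall>I\<in>stopping f lam. 2 * mes I \<le> chord y (Inf I)) \<and> (\<forall>K. overlap f lam K y \<le> 1))"
    define majorant where "majorant = (\<lambda>u i g. continuous_on UNIV g \<and>
      (LINT t:circle|lebesgue. (norm (g t))\<^sup>2) \<le> 2 * lam * norm1 f \<and>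
      (\<forall>y\<in>circle. good y \<longrightarrow> norm (upper_mean (n i) u y) \<le> 129 * lam + norm (g y :: complex)))"
    have ex: "\<exists>g. majorant u i g" if "i \<ge> 1" "\<And>t. norm (u t) = norm (f t)" "u \<in> L1" for u i
      unfolding majorant_def good_def using n[OF that(1)] by (intro modulated_majorant f lam that) simp
    have "\<forall>i. \<exists>g. i \<ge> 1 \<longrightarrow> majorant f i g" using ex[OF _ refl f] by blast
    then obtain g1 where g1': "\<And>i. i \<ge> 1 \<Longrightarrow> majorant f i (g1 i)" by metis
    have "\<forall>i. \<exists>g. i \<ge> 1 \<longrightarrow> majorant (\<lambda>t. cnj (f t)) i g" using ex[OF _ complex_mod_cnj cnjf] by blast
    then obtain g2 where g2': "\<And>i. i \<ge> 1 \<Longrightarrow> majorant (\<lambda>t. cnj (f t)) i (g2 i)" by metis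
    have g1: "\<And>i. i \<ge> 1 \<Longrightarrow> continuous_on UNIV (g1 i)"
      "\<And>i. i \<ge> 1 \<Longrightarrow> (LINT t:circle|lebesgue. (norm (g1 i t))\<^sup>2) \<le> 2 * lam * norm1 f"
      "\<And>i y. i \<ge> 1 \<Longrightarrow> y \<in> circle \<Longrightarrow> good y \<Longrightarrow> norm (upper_mean (n i) f y) \<le> 129 * lam + norm (g1 i y)"
      using g1' unfolding majorant_def by auto
    have g2: "\<And>i. i \<ge> 1 \<Longrightarrow> continuous_on UNIV (g2 i)"
      "\<And>i. i \<ge> 1 \<Longrightarrow> (LINT t:circle|lebesgue. (norm (g2 i t))\<^sup>2) \<le> 2 * lam * norm1 f"
      "\<And>i y. i \<ge> 1 \<Longrightarrow> y \<in> circle \<Longrightarrow> good y \<Longrightarrow>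
        norm (upper_mean (n i) (\<lambda>t. cnj (f t)) y) \<le> 129 * lam + norm (g2 i y)"
      using g2' unfolding majorant_def by auto
    \<comment> \<open>The majorants are controlled for \<open>i \<ge> 1\<close> only; the value 0 at
      \<open>i = 0\<close> keeps every \<open>G i\<close> continuous.\<close>
    define G where "G = (\<lambda>i y. if i \<ge> 1 then (norm (g1 i y))\<^sup>2 + (norm (g2 i y))\<^sup>2 else 0)"
    define E1 where "E1 = (\<Union>K. {y \<in> circle. \<eta> \<le> overlap f lam K y})"
    \<comment> \<open>The functions \<open>G i\<close> are sums of squares, hence the threshold of
      order \<open>lam\<^sup>2\<close> and a measure of order \<open>norm1 f / lam\<close>.\<close>
    define E2 where "E2 = (\<Union>N. {y \<in> circle. lam\<^sup>2 \<le> (\<Sum>i=1..N. real i powr (- 3 / 2) * G i y)})"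
    note E1 = mes_overlap_le[OF f lam \<eta>(1), folded E1_def]
    have Gc: "continuous_on UNIV (G i)" for i
      unfolding G_def using g1(1) g2(1) by (cases "i \<ge> 1") (auto intro!: continuous_intros)
    have Gi: "(LINT y:circle|lebesgue. G i y) \<le> 4 * lam * norm1 f" if "i \<ge> 1" for i
    proof -
      have "(LINT y:circle|lebesgue. G i y) = (LINT y:circle|lebesgue. (norm (g1 i y))\<^sup>2) + (LINT y:circle|lebesgue. (norm (g2 i y))\<^sup>2)"
        unfolding G_def using that g1(1) g2(1)
        by (simp, intro set_integral_add(2) set_integrable_continuous_circle continuous_intros) auto
      then show ?thesis using g1(2)[OF that] g2(2)[OF that] by simp
    qed
    have G0: "0 \<le> G i y" for i y by (simp add: G_def)
    have nonneg: "0 < lam\<^sup>2" "0 \<le> 4 * lam * norm1 f" using lam0 norm1_nonneg[of f] by simp_all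
    have "E2 \<in> sets lebesgue" "mes E2 \<le> Z * (4 * lam * norm1 f) / lam\<^sup>2"
      unfolding E2_def
      by (rule mes_weighted_sum_le[where G = G and w = "\<lambda>i. real i powr (- 3 / 2)", OF Gc G0 powr_ge_zero Gi Z nonneg]; assumption)+
    then have E2: "E2 \<in> sets lebesgue" "mes E2 \<le> 4 * Z * (norm1 f / lam)"
      using lam0 by (simp_all add: power2_eq_square field_simps)
    define X where "X = {y \<in> circle. (SUP N\<in>{1..}. ereal (norm (T_loc \<beta> \<delta> lam n N f y - T_op n N f y))) > ereal (lam / 2)}"
    have "X \<subseteq> E1 \<union> E2"
    proof (rule ccontr)
      assume "\<not> X \<subseteq> E1 \<union> E2"
      then obtain y where y: "y \<in> X" "y \<notin> E1" "y \<notin> E2" by blast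
      then have yc: "y \<in> circle" by (simp add: X_def)
      have M: "overlap f lam K y < \<eta>" for K using y(2) yc unfolding E1_def by (auto simp: not_le)
      have ch: "2 * real \<beta> * mes I \<le> chord y (Inf I)" if I: "I \<in> stopping f lam" for I
      proof -
        obtain K where K: "I \<in> stopping_upto f lam K" using stopping_in_upto[OF I] by blast
        have "bump (Inf I) (mes I) y \<le> overlap f lam K y"
          unfolding overlap_def by (rule member_le_sum[OF K]) (auto intro: finite_stopping_upto)
        then have "bump (Inf I) (mes I) y \<le> 1 / (1 + (2 * real \<beta>)\<^sup>2)" using M[of K] \<eta>(2) by linarith
        then show ?thesis using stopping_upto_dyadic(1)[OF K] by (rule chord_ge_of_bump_le)
      qed
      have "good y"
        unfolding good_def
      proof (intro conjI ballI allI)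
        fix I assume I: "I \<in> stopping f lam"
        have "1 * (2 * mes I) \<le> real \<beta> * (2 * mes I)" using \<beta> by (intro mult_right_mono) auto
        then show "2 * mes I \<le> chord y (Inf I)" using ch[OF I] by simp
      next
        fix K show "overlap f lam K y \<le> 1" using M[of K] \<eta>1 by linarith
      qed
      have h: "norm (fourier_sum (n i) f y - vp_mean (n i) f y) \<le> 260 * lam + G i y / lam" if i: "i \<ge> 1" for i
      proof -
        \<comment> \<open>Makes the majorant quadratic, so that only square integrals are needed;
          used twice, it raises 2 * 129 to 260.\<close>
        have le: "a \<le> lam + a\<^sup>2 / lam" for a :: real
        proof -
          have "a * lam \<le> lam\<^sup>2 + a\<^sup>2"
            using sum_squares_bound[of a lam] zero_le_power2[of a] zero_le_power2[of lam] by linarith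
          then show ?thesis using lam0 by (simp add: field_simps power2_eq_square)
        qed
        have "norm (fourier_sum (n i) f y - vp_mean (n i) f y)
            \<le> norm (upper_mean (n i) f y) + norm (upper_mean (n i) (\<lambda>t. cnj (f t)) y)"
        proof -
          have eq: "fourier_sum (n i) f y - vp_mean (n i) f y
              = - (upper_mean (n i) f y + cnj (upper_mean (n i) (\<lambda>t. cnj (f t)) y))"
            using n[OF i] by (intro fourier_sum_minus_vp_mean) simp
          show ?thesis
            unfolding eq norm_minus_cancel by (rule order_trans[OF norm_triangle_ineq]) simp
        qed
        also have "\<dots> \<le> (129 * lam + norm (g1 i y)) + (129 * lam + norm (g2 i y))"
          by (intro add_mono g1(3) g2(3) i yc \<open>good y\<close>)
        also have "\<dots> \<le> 260 * lam + G i y / lam"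
          using le[of "norm (g1 i y)"] le[of "norm (g2 i y)"] i by (simp add: G_def add_divide_distrib)
        finally show ?thesis .
      qed
      have "norm (T_loc \<beta> \<delta> lam n N f y - T_op n N f y) \<le> lam / 2" if N: "N \<ge> 1" for N
      proof -
        have "(\<Sum>i=1..N. real i powr (- 3 / 2) * G i y) < lam\<^sup>2"
          using y(3) yc unfolding E2_def by (auto simp: not_le)
        then have "(\<Sum>i=1..N. real i powr (- 3 / 2) * G i y) / lam \<le> lam"
          using lam0 by (simp add: divide_le_eq power2_eq_square)
        then have "(\<Sum>i=1..N. real i powr (- 3 / 2) * (G i y / lam)) \<le> lam"
          by (simp add: sum_divide_distrib)
        then have "norm (T_loc \<beta> \<delta> lam n N f y - T_op n N f y) \<le> 768 * real \<beta> * \<eta> * (260 * lam * Z + lam)"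
          using M[THEN less_imp_le] ch h Z lam0 N n \<delta> \<beta>
          by (intro norm_T_loc_minus_T_op_le[where G = "\<lambda>i. G i y / lam"]) auto
        also have "\<dots> = \<eta> * (1536 * real \<beta> * (260 * Z + 1)) * (lam / 2)" by (simp add: algebra_simps)
        also have "\<dots> \<le> 1 * (lam / 2)"
          using \<eta>(3) den(2) lam0 by (intro mult_right_mono) (auto simp: pos_le_divide_eq)
        finally show ?thesis by simp
      qed
      then have "(SUP N\<in>{1..}. ereal (norm (T_loc \<beta> \<delta> lam n N f y - T_op n N f y))) \<le> ereal (lam / 2)"
        by (intro SUP_least) simp
      moreover have "(SUP N\<in>{1..}. ereal (norm (T_loc \<beta> \<delta> lam n N f y - T_op n N f y))) > ereal (lam / 2)"
        using y(1) unfolding X_def mem_Collect_eq by (rule conjunct2)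
      ultimately show False by (rule leD[THEN notE])
    qed
    have "E1 \<union> E2 \<subseteq> circle" unfolding E1_def E2_def by blast
    then have E12: "E1 \<union> E2 \<in> lmeasurable"
      using fmeasurableI2[OF mes_circle(3)] sets.Un[OF E1(1) E2(1)] by blast
    define x where "x = norm1 f / lam"
    have x: "0 \<le> x" "x \<le> 2 * pi"
      using lam lam0 norm1_nonneg[of f] by (auto simp: x_def field_simps)
    have "mes X \<le> C * x"
    \<comment> \<open>For a nonmeasurable set \<open>measure\<close> has the default value 0, so the
      case distinction stands in for a measurability proof of \<open>X\<close>.\<close>
    proof (cases "X \<in> sets lebesgue")
      case True
      have "mes X \<le> mes (E1 \<union> E2)" using \<open>X \<subseteq> E1 \<union> E2\<close> True E12 by (rule measure_mono_fmeasurable)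
      also have "\<dots> \<le> mes E1 + mes E2" using E1(1) E2(1) by (rule measure_Un_le)
      also have "\<dots> \<le> C * x" using E1(2) E2(2) by (simp add: C_def x_def algebra_simps)
      finally show ?thesis .
    next
      case False
      then show ?thesis using C x by (simp add: measure_notin_sets)
    qed
    also have "C * x = C * (sqrt x * sqrt x)" using x by simp
    \<comment> \<open>Since x \<le> 2 pi, one of the two square roots is absorbed in the
      constant.\<close>
    also have "\<dots> \<le> C * (sqrt (2 * pi) * sqrt x)"
      using C x by (intro mult_left_mono mult_right_mono) auto
    also have "\<dots> \<le> C * (sqrt (2 * pi) * sqrt x) * (1 / (1 - 2 * \<delta>))"
    proof -
      have "1 \<le> 1 / (1 - 2 * \<delta>)" using \<delta> by simp
      moreover have "0 \<le> C * (sqrt (2 * pi) * sqrt x)" using C x by auto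
      ultimately show ?thesis using mult_left_mono by fastforce
    qed
    finally show "mes {y \<in> circle. (SUP N\<in>{1..}. ereal (norm (T_loc \<beta> \<delta> lam n N f y - T_op n N f y))) > ereal (lam / 2)}
      \<le> C * sqrt (2 * pi) * (1 / (1 - 2 * \<delta>)) * sqrt (norm1 f / lam)"
      by (simp add: X_def x_def mult_ac)
  qed
qed

end
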